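(* Let $(q_k)_{k\ge 1}$ be a sequence of positive integers with $q_{k+1}\ge q_k(q_k+1)$ for all $k\ge 1$, let $(\xi_k)_{k\ge1}$ be independent random variables with $\mathsf{P}\{\xi_k=0\}=p_{0k}$, $\mathsf{P}\{\xi_k=1\}=p_{1k}$, $p_{0k},p_{1k}\ge 0$, $p_{0k}+p_{1k}=1$, and assume that $\max\{p_{0k},p_{1k}\}<1$ for infinitely many $k$. Let $\mu$ be the distribution of $$\xi=\sum_{k=1}^\infty \frac{(-1)^{k+1}\xi_k}{q_k},$$ and let $\nu^*$ be the uniform distribution on the spectrum of $\mu$ (as defined in the context). Let $h_n=-(p_{0n}\ln p_{0n}+p_{1n}\ln p_{1n})$ be the entropy of $\xi_n$ (with $0\ln 0=0$), let $H_n=h_1+h_2+\dots+h_n$, and let $g_n$ be the number of positive elements among $h_1,\dots,h_n$. Then the Hausdorff–Billingsley dimension of $\mu$ with respect to $\nu^*$ is $$\dim_H(\mu,\nu^* )=\liminf_{n\to\infty}\frac{H_n}{g_n\ln 2}.$$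
   Context: The measure $\nu^*$ is the distribution of the random variable $\xi^*=\sum_{k=1}^\infty\frac{(-1)^{k+1}\xi^*_k}{q_k}$, where $\xi^*_k$ are independent random variables taking the values $0$ and $1$ with probabilities $p^*_{0k}$ and $p^*_{1k}$ such that, for $i\in\{0,1\}$: $p^*_{ik}=0$ iff $p_{ik}=0$; $p^*_{ik}=1$ iff $p_{ik}=1$; $p^*_{ik}=\frac12$ iff $p_{ik}\in(0,1)$. For a continuous (atomless) probability measure $\nu$ on $\mathbb{R}$, a bounded set $E\subset\mathbb{R}$ and $\alpha>0$, put $$H^\alpha(E,\nu)=\lim_{\varepsilon\to0}\ \inf\Big\{\sum_j(\nu(E_j))^\alpha\Big\},$$ where the infimum is over all at most countable coverings $\{E_j\}$ of $E$ by closed intervals with $\nu(E_j)\le\varepsilon$ (one may restrict to subintervals of a fixed bounded closed interval containing $E$). The Hausdorff–Billingsley dimension of $E$ with respect to $\nu$ is $\dim_H(E,\nu)=\inf\{\alpha>0: H^\alpha(E,\nu)=0\}$. The Hausdorff–Billingsley dimension of a probability measure $\mu$ (with bounded support) with respect to $\nu$ is $\dim_H(\mu,\nu)=\inf\{\dim_H(E,\nu): E \text{ a bounded Borel set},\ \mu(E)=1\}$. The assumption that $\max\{p_{0k},p_{1k}\}<1$ for infinitely many $k$ is equivalent to continuity of $\nu^*$, and guarantees $g_n\ge1$ for all large $n$. *)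

theory Defs
  imports "HOL-Probability.Probability"
begin

text \<open>
  The sequences of coefficients \<open>a\<close> and denominators \<open>q\<close> are indexed by \<open>k \<ge> 1\<close>;
  the values at \<open>0\<close> are never used. Hence the shift in the library series.
\<close>

definition alternating_sum :: "(nat \<Rightarrow> nat) \<Rightarrow> (nat \<Rightarrow> real) \<Rightarrow> real" where
  "alternating_sum q a = (\<Sum>k. (-1) ^ (Suc k + 1) * a (Suc k) / real (q (Suc k)))"

text \<open>Turns \<open>p\<^sub>i\<^sub>k\<close> into \<open>p\<^sup>*\<^sub>i\<^sub>k\<close>; only applied to \<open>p \<in> {0..1}\<close>.\<close>

definition uniform_weight :: "real \<Rightarrow> real" where
  "uniform_weight p = (if p = 0 then 0 else if p = 1 then 1 else 1 / 2)"

text \<open>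
  At most countable coverings of \<open>E\<close> by bounded closed intervals of \<open>\<nu>\<close>-measure at most \<open>\<epsilon>\<close>.
  The interval \<open>{a..b}\<close> is empty for \<open>b < a\<close>, so finite coverings are included by padding with
  empty intervals, which contribute \<open>0 powr \<alpha> = 0\<close> to the sums below.
\<close>

definition interval_coverings :: "real measure \<Rightarrow> real \<Rightarrow> real set \<Rightarrow> (nat \<Rightarrow> real set) set" where
  "interval_coverings \<nu> \<epsilon> E =
     {C. (\<forall>j. \<exists>a b. C j = {a..b}) \<and> (\<forall>j. measure \<nu> (C j) \<le> \<epsilon>) \<and> E \<subseteq> (\<Union>j. C j)}"

definition hausdorff_billingsley_pre :: "real \<Rightarrow> real \<Rightarrow> real set \<Rightarrow> real measure \<Rightarrow> ennreal" where
  "hausdorff_billingsley_pre \<alpha> \<epsilon> E \<nu> =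
     (INF C\<in>interval_coverings \<nu> \<epsilon> E. \<Sum>j. ennreal (measure \<nu> (C j) powr \<alpha>))"

definition hausdorff_billingsley_measure :: "real \<Rightarrow> real set \<Rightarrow> real measure \<Rightarrow> ennreal" where
  "hausdorff_billingsley_measure \<alpha> E \<nu> =
     Lim (at_right 0) (\<lambda>\<epsilon>. hausdorff_billingsley_pre \<alpha> \<epsilon> E \<nu>)"

text \<open>The limit always exists, because the infimum increases as \<open>\<epsilon>\<close> decreases.\<close>

lemma hausdorff_billingsley_pre_antimono:
  assumes "\<epsilon> \<le> \<epsilon>'"
  shows "hausdorff_billingsley_pre \<alpha> \<epsilon>' E \<nu> \<le> hausdorff_billingsley_pre \<alpha> \<epsilon> E \<nu>"
proof -
  have "interval_coverings \<nu> \<epsilon> E \<subseteq> interval_coverings \<nu> \<epsilon>' E"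
    using assms unfolding interval_coverings_def by (auto intro: order_trans)
  then show ?thesis
    unfolding hausdorff_billingsley_pre_def by (intro INF_superset_mono) auto
qed

lemma tendsto_hausdorff_billingsley_SUP:
  "((\<lambda>\<epsilon>. hausdorff_billingsley_pre \<alpha> \<epsilon> E \<nu>) \<longlongrightarrow>
      (SUP \<epsilon>\<in>{0<..}. hausdorff_billingsley_pre \<alpha> \<epsilon> E \<nu>)) (at_right 0)"
proof (rule order_tendstoI)
  fix y assume "y < (SUP \<epsilon>\<in>{0<..}. hausdorff_billingsley_pre \<alpha> \<epsilon> E \<nu>)"
  then obtain e where e: "0 < e" "y < hausdorff_billingsley_pre \<alpha> e E \<nu>"
    by (auto simp: less_SUP_iff)
  show "\<forall>\<^sub>F \<epsilon> in at_right 0. y < hausdorff_billingsley_pre \<alpha> \<epsilon> E \<nu>"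
    unfolding eventually_at_right_field
    by (intro exI[of _ e] conjI allI impI e(1)
        less_le_trans[OF e(2) hausdorff_billingsley_pre_antimono]) simp
next
  fix y assume y: "(SUP \<epsilon>\<in>{0<..}. hausdorff_billingsley_pre \<alpha> \<epsilon> E \<nu>) < y"
  have "hausdorff_billingsley_pre \<alpha> \<epsilon> E \<nu> < y" if "0 < \<epsilon>" for \<epsilon>
    using that by (intro le_less_trans[OF SUP_upper y]) simp
  then show "\<forall>\<^sub>F \<epsilon> in at_right 0. hausdorff_billingsley_pre \<alpha> \<epsilon> E \<nu> < y"
    unfolding eventually_at_right_field by (intro exI[of _ 1]) simp
qed

lemma hausdorff_billingsley_measure_eq_SUP:
  "hausdorff_billingsley_measure \<alpha> E \<nu> = (SUP \<epsilon>\<in>{0<..}. hausdorff_billingsley_pre \<alpha> \<epsilon> E \<nu>)"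
  unfolding hausdorff_billingsley_measure_def
  by (rule tendsto_Lim[OF trivial_limit_at_right_real tendsto_hausdorff_billingsley_SUP])

definition hausdorff_billingsley_dim :: "real set \<Rightarrow> real measure \<Rightarrow> ereal" where
  "hausdorff_billingsley_dim E \<nu> =
     (INF \<alpha>\<in>{\<alpha>. \<alpha> > 0 \<and> hausdorff_billingsley_measure \<alpha> E \<nu> = 0}. ereal \<alpha>)"

definition hausdorff_billingsley_dim_measure :: "real measure \<Rightarrow> real measure \<Rightarrow> ereal" where
  "hausdorff_billingsley_dim_measure \<mu> \<nu> =
     (INF E\<in>{E. bounded E \<and> E \<in> sets borel \<and> measure \<mu> E = 1}. hausdorff_billingsley_dim E \<nu>)"

text \<open>The convention \<open>0 ln 0 = 0\<close> holds automatically.\<close>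

definition binary_entropy :: "real \<Rightarrow> real \<Rightarrow> real" where
  "binary_entropy x y = - (x * ln x + y * ln y)"

end

theory Submission
  imports Defs
begin

text \<open>
  The measure \<open>\<nu>*\<close> gives every cylinder of rank \<open>n\<close> that is possible under \<open>\<mu>\<close> the mass
  \<open>(1 / 2) ^ g n\<close>, while by the law of large numbers \<open>\<mu>\<close> gives a typical one a mass of about
  \<open>exp (- H n)\<close>. So the quotient of the logarithms of the two masses, the local dimension of \<open>\<mu>\<close>
  with respect to \<open>\<nu>*\<close>, is about \<open>H n / (g n * ln 2)\<close>, and its lower limit is the dimension, as
  in Billingsley's theorem.

  Three points need care. First, coverings use arbitrary closed intervals and not cylinders. The
  growth of \<open>q\<close> makes each digit outweigh all later ones, so that the intervals spanned by the
  cylinders of one rank are disjoint (\<open>cyl_intervals_disjoint\<close>); hence an interval whose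
  \<open>\<nu>*\<close>-mass is less than \<open>2 * (1 / 2) ^ g n\<close> meets at most three possible cylinders of rank \<open>n\<close>
  (\<open>card_met_cyls_le\<close>).

  Second, the digit probabilities may approach \<open>0\<close>, and digits may be deterministic. For
  \<open>\<bar>s\<bar> \<le> 1 / 2\<close> the sum \<open>x powr (1 - s) + (1 - x) powr (1 - s)\<close> is at most
  \<open>exp (s * h + 16 * s\<^sup>2)\<close>, where \<open>h\<close> is the entropy of the pair \<open>x, 1 - x\<close>, uniformly in \<open>x\<close>;
  for \<open>h = 0\<close> the sum is \<open>1\<close>. Multiplied over the digits, this makes the total mass of the words
  whose weight deviates from \<open>exp (- H n)\<close> by more than a factor \<open>exp (\<delta> * g n)\<close> exponentially
  small in \<open>g n\<close> (\<open>sum_infrequent_words_le\<close>, \<open>sum_too_frequent_words_le\<close>). This takes the place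
  of the strong law.

  Third, the two bounds use the deviations differently. For the upper bound, along ranks where the
  entropy quotient is close to its lower limit, the few heavy words cover almost all of \<open>\<mu>\<close>
  (\<open>dim_le_of_frequently_less\<close>). For the lower bound the too heavy words must be avoided at all large
  ranks simultaneously, which is a mass distribution argument
  (\<open>hausdorff_billingsley_measure_nonzero_of_eventually_greater\<close>).
\<close>

section \<open>Tilted binary entropy\<close>

lemma exp_le_quadratic: "exp u \<le> 1 + u + u\<^sup>2 / 2 * exp \<bar>u\<bar>" for u :: real
proof -
  obtain t where t: "\<bar>t\<bar> \<le> \<bar>u\<bar>" "exp u = (\<Sum>m<2. u ^ m / fact m) + exp t / fact 2 * u ^ 2"
    using Maclaurin_exp_le by blast
  have "exp t * u\<^sup>2 \<le> exp \<bar>u\<bar> * u\<^sup>2"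
    using t(1) by (intro mult_right_mono) auto
  then show ?thesis
    unfolding t(2) by (simp add: numeral_2_eq_2 fact_numeral power2_eq_square field_simps)
qed

text \<open>
  Writing \<open>p = exp (- y)\<close>, the left side is \<open>p * exp (s * y)\<close>, and the second-order Taylor remainder
  is at most \<open>s\<^sup>2 / 2\<close> times \<open>y\<^sup>2 * exp (- y / 2)\<close>, which is bounded uniformly in \<open>y \<ge> 0\<close>. It is this
  uniformity that makes all later estimates independent of how close the digit probabilities come
  to \<open>0\<close> or \<open>1\<close>.
\<close>

lemma powr_tilt_le:
  fixes p s :: real
  assumes p: "0 \<le> p" "p \<le> 1" and s: "\<bar>s\<bar> \<le> 1 / 2"
  shows "p powr (1 - s) \<le> p - s * (p * ln p) + 8 * s\<^sup>2"
proof (cases "p = 0")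
  case False
  with p have p0: "0 < p" by simp
  define y where "y = - ln p"
  have y: "0 \<le> y" "p = exp (- y)"
    using p0 p by (auto simp: y_def)
  have "y / 4 \<le> exp (y / 4)"
    using exp_ge_add_one_self[of "y / 4"] by linarith
  then have "(y / 4)\<^sup>2 \<le> (exp (y / 4))\<^sup>2"
    using y by (intro power_mono) auto
  also have "\<dots> = exp (y / 2)"
    by (simp add: power2_eq_square flip: exp_add)
  finally have y2: "y\<^sup>2 \<le> 16 * exp (y / 2)"
    by (simp add: power_divide)
  have "\<bar>s * y\<bar> \<le> y / 2"
    using mult_right_mono[OF s y(1)] y(1) by (simp add: abs_mult)
  then have "exp \<bar>s * y\<bar> \<le> exp (y / 2)" by (simp only: exp_le_cancel_iff)
  then have "exp (s * y) \<le> 1 + s * y + (s * y)\<^sup>2 / 2 * exp (y / 2)"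
    by (rule order_trans[OF exp_le_quadratic add_left_mono[OF mult_left_mono]]) simp
  then have "p * exp (s * y) \<le> p * (1 + s * y + (s * y)\<^sup>2 / 2 * exp (y / 2))"
    using p0 by (intro mult_left_mono) auto
  also have "\<dots> = p + s * (p * y) + s\<^sup>2 / 2 * (y\<^sup>2 * (p * exp (y / 2)))"
    by (simp add: algebra_simps power2_eq_square)
  also have "p * exp (y / 2) = exp (- (y / 2))"
    unfolding y(2) by (simp flip: exp_add)
  also have "y\<^sup>2 * exp (- (y / 2)) \<le> 16 * exp (y / 2) * exp (- (y / 2))"
    using y2 by (intro mult_right_mono) auto
  also have "\<dots> = 16"
    by (simp flip: exp_add)
  finally have "p * exp (s * y) \<le> p + s * (p * y) + s\<^sup>2 / 2 * 16"
    by (simp add: mult_left_mono)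
  moreover have "p powr (1 - s) = p * exp (s * y)"
    using p0 by (simp add: powr_def y_def algebra_simps exp_diff exp_minus field_simps)
  ultimately show ?thesis
    by (simp add: y_def)
qed simp

lemma binary_entropy_pos_iff:
  assumes "0 \<le> x" "0 \<le> y" "x + y = 1"
  shows "0 < binary_entropy x y \<longleftrightarrow> x \<noteq> 0 \<and> y \<noteq> 0"
proof (cases "x = 0 \<or> y = 0")
  case False
  with assms have "0 < x" "x < 1" "0 < y" "y < 1" by auto
  then have "x * ln x < 0" "y * ln y < 0"
    by (auto intro!: mult_pos_neg)
  then show ?thesis using False by (simp add: binary_entropy_def)
qed (use assms in \<open>auto simp: binary_entropy_def\<close>)

lemma binary_entropy_nonneg:
  assumes "0 \<le> x" "0 \<le> y" "x + y = 1"
  shows "0 \<le> binary_entropy x y"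
proof (cases "x = 0 \<or> y = 0")
  case False
  then show ?thesis using binary_entropy_pos_iff[OF assms] by simp
qed (use assms in \<open>auto simp: binary_entropy_def\<close>)

text \<open>
  The moment generating function, at \<open>s\<close>, of minus the logarithm of the probability of a random
  digit. A deterministic digit contributes the factor \<open>1\<close>, so the quadratic error is paid only
  for digits of positive entropy; this is why errors are later measured against \<open>g n\<close> and not
  against \<open>n\<close>. Both signs of \<open>s\<close> are used, one for each tail.
\<close>

lemma sum_powr_tilt_le_exp:
  assumes "0 \<le> x" "0 \<le> y" "x + y = 1" and s: "\<bar>s\<bar> \<le> 1 / 2"
  shows "x powr (1 - s) + y powr (1 - s)
           \<le> exp (s * binary_entropy x y + 16 * s\<^sup>2 * of_bool (0 < binary_entropy x y))"
proof (cases "x = 0 \<or> y = 0")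
  case False
  then have "0 < binary_entropy x y"
    using binary_entropy_pos_iff[OF assms(1-3)] by simp
  moreover have "x powr (1 - s) + y powr (1 - s) \<le> 1 + (s * binary_entropy x y + 16 * s\<^sup>2)"
    using powr_tilt_le[of x s] powr_tilt_le[of y s] assms
    by (simp add: binary_entropy_def algebra_simps)
  ultimately show ?thesis
    using exp_ge_add_one_self[of "s * binary_entropy x y + 16 * s\<^sup>2"]
    by (simp del: exp_ge_add_one_self)
qed (use assms in \<open>auto simp: binary_entropy_def\<close>)

section \<open>Cylinder intervals of the alternating expansion\<close>

text \<open>
  A word of length \<open>n\<close> is encoded by the set \<open>A \<subseteq> {1..n}\<close> of the positions of its ones. The sums
  whose first \<open>n\<close> digits spell \<open>A\<close> form a set which, because the signs alternate, is not symmetric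
  about the point with all further digits \<open>0\<close>; it is symmetric about the point with all further
  digits \<open>1 / 2\<close>. The cylinder interval is the smallest closed interval containing that set.
\<close>

definition tail :: "(nat \<Rightarrow> nat) \<Rightarrow> nat \<Rightarrow> real" where
  "tail q n = (\<Sum>k. of_bool (n < Suc k) / real (q (Suc k)))"

definition centre :: "(nat \<Rightarrow> nat) \<Rightarrow> nat \<Rightarrow> nat set \<Rightarrow> real" where
  "centre q n A = alternating_sum q (\<lambda>k. if k \<le> n then of_bool (k \<in> A) else 1 / 2)"

definition cyl_interval :: "(nat \<Rightarrow> nat) \<Rightarrow> nat \<Rightarrow> nat set \<Rightarrow> real set" where
  "cyl_interval q n A = {centre q n A - tail q n / 2 .. centre q n A + tail q n / 2}"

locale fast_growth =
  fixes q :: "nat \<Rightarrow> nat"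
  assumes q_pos: "\<And>k. k \<ge> 1 \<Longrightarrow> q k > 0"
    and q_growth: "\<And>k. k \<ge> 1 \<Longrightarrow> q (k + 1) \<ge> q k * (q k + 1)"
begin

lemma q_geometric: assumes "1 \<le> k" shows "2 * 3 ^ i * q k \<le> q (Suc (k + i))"
proof (induction i)
  case 0
  have "q k * 2 \<le> q k * (q k + 1)"
    using q_pos[OF assms] by (intro mult_left_mono) auto
  also have "\<dots> \<le> q (Suc k)" using q_growth[OF assms] by simp
  finally show ?case by (simp add: mult.commute)
next
  case (Suc i)
  have "2 * 1 * 1 \<le> 2 * 3 ^ i * q k"
    using q_pos[OF assms] by (intro mult_mono) auto
  with Suc have "2 \<le> q (Suc (k + i))" by linarith
  then have "q (Suc (k + i)) * 3 \<le> q (Suc (k + i)) * (q (Suc (k + i)) + 1)"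
    by (intro mult_left_mono) auto
  also have "\<dots> \<le> q (Suc (k + Suc i))"
    using q_growth[of "Suc (k + i)"] by simp
  finally show ?case using Suc by simp
qed

lemma inverse_q_le: assumes "1 \<le> k" shows "1 / q (Suc (k + i)) \<le> 1 / (2 * q k) * (1 / 3) ^ i"
proof -
  have "real (2 * 3 ^ i * q k) \<le> q (Suc (k + i))"
    using q_geometric[OF assms] by (intro of_nat_mono)
  then show ?thesis
    using q_pos[OF assms] q_pos[of "Suc (k + i)"]
    by (simp add: power_one_over divide_simps) (simp add: mult.commute mult.left_commute)
qed

lemma summable_inverse_q: "summable (\<lambda>k. 1 / real (q (Suc k)))"
proof -
  have "summable (\<lambda>i. 1 / real (q (Suc (i + 1))))"
  proof (rule summable_comparison_test')
    show "summable (\<lambda>i. 1 / (2 * real (q 1)) * (1 / 3) ^ i)"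
      by (intro summable_mult summable_geometric) simp
    show "norm (1 / real (q (Suc (i + 1)))) \<le> 1 / (2 * real (q 1)) * (1 / 3) ^ i" if "0 \<le> i" for i
      using inverse_q_le[of 1 i] by (simp add: add.commute)
  qed
  then show ?thesis
    by (subst (asm) summable_iff_shift[of "\<lambda>k. 1 / real (q (Suc k))"])
qed

lemma summable_digits:
  assumes "\<And>k. k \<ge> 1 \<Longrightarrow> \<bar>a k\<bar> \<le> 1"
  shows "summable (\<lambda>k. (-1) ^ (Suc k + 1) * a (Suc k) / real (q (Suc k)))"
    "summable (\<lambda>k. \<bar>a (Suc k)\<bar> / real (q (Suc k)))"
proof -
  show *: "summable (\<lambda>k. \<bar>a (Suc k)\<bar> / real (q (Suc k)))"
    by (rule summable_comparison_test'[OF summable_inverse_q])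
      (use assms in \<open>auto intro!: divide_right_mono\<close>)
  show "summable (\<lambda>k. (-1) ^ (Suc k + 1) * a (Suc k) / real (q (Suc k)))"
    by (rule summable_comparison_test'[OF *]) (auto simp: abs_mult)
qed

text \<open>
  The growth condition gives \<open>q (k + 1) \<ge> 2 * q k\<close> and a factor of at least \<open>3\<close> from then on,
  hence the tail is at most \<open>1 / 2 * (1 + 1 / 3 + 1 / 9 + \<dots>) = 3 / 4\<close> of the term before it: a
  digit outweighs all later digits together.
\<close>

lemma tail_less: assumes "1 \<le> k" shows "tail q k < 1 / q k"
proof -
  have sm: "summable (\<lambda>j. of_bool (k < Suc j) / real (q (Suc j)))"
    using summable_digits(2)[of "\<lambda>j. of_bool (k < j)"] by simp
  have "tail q k = (\<Sum>i. of_bool (k < Suc (i + k)) / real (q (Suc (i + k))))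
                     + (\<Sum>j<k. of_bool (k < Suc j) / real (q (Suc j)))"
    unfolding tail_def by (rule suminf_split_initial_segment[OF sm])
  also have "\<dots> = (\<Sum>i. 1 / real (q (Suc (k + i))))"
    by (simp add: add.commute)
  also have "\<dots> \<le> (\<Sum>i. 1 / (2 * real (q k)) * (1 / 3) ^ i)"
    using inverse_q_le[OF assms] summable_inverse_q
    by (intro suminf_le summable_mult summable_geometric)
       (auto simp: summable_iff_shift[of "\<lambda>k. 1 / real (q (Suc k))", of k] add.commute[of k])
  also have "\<dots> = 3 / 4 / q k"
    by (subst suminf_mult) (simp_all add: suminf_geometric summable_geometric)
  also have "\<dots> < 1 / q k"
    using q_pos[OF assms] by (simp add: field_simps)
  finally show ?thesis .
qed

lemma alternating_sum_diff:
  assumes "\<And>k. k \<ge> 1 \<Longrightarrow> \<bar>a k\<bar> \<le> 1" "\<And>k. k \<ge> 1 \<Longrightarrow> \<bar>b k\<bar> \<le> 1"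
  shows "alternating_sum q a - alternating_sum q b
    = (\<Sum>k. (-1) ^ (Suc k + 1) * (a (Suc k) - b (Suc k)) / real (q (Suc k)))"
  using suminf_diff[OF summable_digits(1)[OF assms(1)] summable_digits(1)[OF assms(2)]]
  by (simp add: alternating_sum_def right_diff_distrib diff_divide_distrib)

lemma alternating_sum_diff_le:
  assumes "\<And>k. k \<ge> 1 \<Longrightarrow> \<bar>a k\<bar> \<le> 1" "\<And>k. k \<ge> 1 \<Longrightarrow> \<bar>b k\<bar> \<le> 1"
    "\<And>k. k \<ge> 1 \<Longrightarrow> \<bar>a k - b k\<bar> \<le> c * of_bool (n < k)"
  shows "\<bar>alternating_sum q a - alternating_sum q b\<bar> \<le> c * tail q n"
proof -
  let ?d = "\<lambda>k. (-1) ^ (Suc k + 1) * (a (Suc k) - b (Suc k)) / real (q (Suc k))"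
  let ?t = "\<lambda>k. of_bool (n < Suc k) / real (q (Suc k))"
  have t: "summable ?t" using summable_digits(2)[of "\<lambda>j. of_bool (n < j)"] by simp
  have le: "\<bar>?d k\<bar> \<le> c * ?t k" for k
    using assms(3)[of "Suc k"] by (simp add: abs_mult divide_right_mono)
  have sd: "summable (\<lambda>k. \<bar>?d k\<bar>)"
    by (rule summable_comparison_test'[OF summable_mult[OF t, of c]]) (use le in auto)
  have "alternating_sum q a - alternating_sum q b = suminf ?d"
    using assms(1,2) by (rule alternating_sum_diff)
  then have "\<bar>alternating_sum q a - alternating_sum q b\<bar> \<le> (\<Sum>k. \<bar>?d k\<bar>)"
    using summable_rabs[OF sd] by simp
  also have "\<dots> \<le> (\<Sum>k. c * ?t k)"
    using le by (intro suminf_le summable_mult t sd)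
  also have "\<dots> = c * tail q n"
    unfolding tail_def by (rule suminf_mult[OF t])
  finally show ?thesis .
qed

text \<open>
  The first digit that differs shifts the sum by \<open>1 / q k\<close>, which the later digits cannot undo.
  Real-valued digits are allowed after that position, so that the statement covers whole intervals
  and not only their Cantor-like subsets.
\<close>

lemma alternating_sum_neq:
  assumes a: "\<And>k. k \<ge> 1 \<Longrightarrow> a k \<in> {0..1}" and b: "\<And>k. k \<ge> 1 \<Longrightarrow> b k \<in> {0..1}"
    and k: "1 \<le> k" and diff: "\<bar>a k - b k\<bar> = 1"
    and eq: "\<And>j. 1 \<le> j \<Longrightarrow> j < k \<Longrightarrow> a j = b j"
  shows "alternating_sum q a \<noteq> alternating_sum q b"
proof
  assume "alternating_sum q a = alternating_sum q b"
  moreover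
  let ?b' = "b(k := a k)"
  have b': "\<And>k. k \<ge> 1 \<Longrightarrow> ?b' k \<in> {0..1}"
    using a b by auto
  have "\<bar>alternating_sum q a - alternating_sum q ?b'\<bar> \<le> 1 * tail q k"
  proof (rule alternating_sum_diff_le)
    fix j :: nat assume j: "1 \<le> j"
    show "\<bar>a j\<bar> \<le> 1" "\<bar>?b' j\<bar> \<le> 1"
      using a[OF j] b'[OF j] by auto
    show "\<bar>a j - ?b' j\<bar> \<le> 1 * of_bool (k < j)"
      using a[OF j] b[OF j] eq[OF j] by (cases j k rule: linorder_cases) auto
  qed
  moreover have "alternating_sum q ?b' - alternating_sum q b = (-1) ^ (k + 1) * (a k - b k) / q k"
  proof -
    have "alternating_sum q ?b' - alternating_sum q b
        = (\<Sum>j. (-1) ^ (Suc j + 1) * (?b' (Suc j) - b (Suc j)) / real (q (Suc j)))"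
      by (rule alternating_sum_diff) (use b b' in \<open>auto simp del: fun_upd_apply\<close>)
    also have "\<dots> = (\<Sum>j\<in>{k - 1}. (-1) ^ (Suc j + 1) * (?b' (Suc j) - b (Suc j)) / real (q (Suc j)))"
      by (rule suminf_finite) auto
    finally show ?thesis using k by simp
  qed
  then have "\<bar>alternating_sum q ?b' - alternating_sum q b\<bar> = 1 / q k"
    using diff by (simp add: abs_mult)
  ultimately show False
    using tail_less[OF k] by linarith
qed

text \<open>
  The points of the cylinder interval are exactly the sums whose digits after position \<open>n\<close> range
  over the whole of \<open>{0..1}\<close>. This turns questions about intervals into questions about digits.
\<close>

lemma mem_cyl_interval_iff:
  "x \<in> cyl_interval q n A \<longleftrightarrow>
     (\<exists>a. (\<forall>k\<ge>1. a k \<in> {0..1} \<and> (k \<le> n \<longrightarrow> a k = of_bool (k \<in> A))) \<and> x = alternating_sum q a)"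
proof
  let ?c = "\<lambda>k. if k \<le> n then of_bool (k \<in> A) else 1 / 2 :: real"
  have t: "summable (\<lambda>k. of_bool (n < Suc k) / real (q (Suc k)))"
    using summable_digits(2)[of "\<lambda>j. of_bool (n < j)"] by simp
  {
    assume "\<exists>a. (\<forall>k\<ge>1. a k \<in> {0..1} \<and> (k \<le> n \<longrightarrow> a k = of_bool (k \<in> A))) \<and> x = alternating_sum q a"
    then obtain a where a: "\<And>k. 1 \<le> k \<Longrightarrow> a k \<in> {0..1} \<and> (k \<le> n \<longrightarrow> a k = of_bool (k \<in> A))"
      and x: "x = alternating_sum q a" by blast
    have "\<bar>alternating_sum q a - alternating_sum q ?c\<bar> \<le> 1 / 2 * tail q n"
    proof (rule alternating_sum_diff_le)
      fix k :: nat assume k: "1 \<le> k"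
      show "\<bar>a k\<bar> \<le> 1" "\<bar>?c k\<bar> \<le> 1" using a[OF k] by auto
      have "\<bar>a k - 1 / 2\<bar> \<le> 1 / 2" using a[OF k] unfolding abs_le_iff by auto
      then show "\<bar>a k - ?c k\<bar> \<le> 1 / 2 * of_bool (n < k)" using a[OF k] by auto
    qed
    then show "x \<in> cyl_interval q n A"
      unfolding cyl_interval_def centre_def x atLeastAtMost_iff abs_le_iff by linarith
  }
  assume "x \<in> cyl_interval q n A"
  then have *: "\<bar>x - centre q n A\<bar> \<le> tail q n / 2"
    unfolding cyl_interval_def abs_le_iff by auto
  \<comment> \<open>A point at relative position \<open>\<theta>\<close> in the interval is reached by giving the digits of positive
     sign the value \<open>(1 + \<theta>) / 2\<close> and those of negative sign the value \<open>(1 - \<theta>) / 2\<close>.\<close>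
  obtain \<theta> where \<theta>: "\<bar>\<theta>\<bar> \<le> 1" "x - centre q n A = \<theta> * (tail q n / 2)"
  proof (cases "tail q n = 0")
    case True
    then show ?thesis using * that[of 0] by simp
  next
    case False
    have "0 \<le> tail q n" using * by linarith
    with False have "0 < tail q n" by simp
    then show ?thesis
      using * by (intro that[of "(x - centre q n A) / (tail q n / 2)"])
        (simp_all add: abs_divide pos_divide_le_eq del: divide_divide_eq_right)
  qed
  define a where "a k = (if k \<le> n then of_bool (k \<in> A) else 1 / 2 + (-1) ^ (k + 1) * \<theta> / 2)" for k
  have "\<bar>(-1) ^ (k + 1) * \<theta>\<bar> \<le> 1" for k
    using \<theta>(1) by (simp add: abs_mult)
  then have th: "-1 \<le> (-1) ^ (k + 1) * \<theta>" "(-1) ^ (k + 1) * \<theta> \<le> 1" for k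
    unfolding abs_le_iff by (simp_all only: minus_le_iff)
  have a01: "a k \<in> {0..1}" for k
    using th[of k] by (auto simp: a_def)
  have "alternating_sum q a - centre q n A
      = (\<Sum>k. (-1) ^ (Suc k + 1) * (a (Suc k) - ?c (Suc k)) / real (q (Suc k)))"
    unfolding centre_def by (rule alternating_sum_diff) (use a01 in auto)
  also have "\<dots> = (\<Sum>k. \<theta> / 2 * (of_bool (n < Suc k) / real (q (Suc k))))"
    by (intro suminf_cong) (auto simp: a_def simp flip: power_add)
  also have "\<dots> = \<theta> * (tail q n / 2)"
    unfolding tail_def by (subst suminf_mult[OF t]) simp
  finally have "x = alternating_sum q a"
    using \<theta>(2) by simp
  then show "\<exists>a. (\<forall>k\<ge>1. a k \<in> {0..1} \<and> (k \<le> n \<longrightarrow> a k = of_bool (k \<in> A))) \<and> x = alternating_sum q a"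
    using a01 by (intro exI[of _ a]) (auto simp: a_def)
qed

lemma cyl_intervals_disjoint:
  assumes "A \<subseteq> {1..n}" "B \<subseteq> {1..n}" "A \<noteq> B"
  shows "cyl_interval q n A \<inter> cyl_interval q n B = {}"
proof (rule ccontr)
  assume "cyl_interval q n A \<inter> cyl_interval q n B \<noteq> {}"
  then obtain x where "x \<in> cyl_interval q n A" "x \<in> cyl_interval q n B" by blast
  then obtain a b where
    a: "\<And>k. 1 \<le> k \<Longrightarrow> a k \<in> {0..1::real} \<and> (k \<le> n \<longrightarrow> a k = of_bool (k \<in> A))" and
    b: "\<And>k. 1 \<le> k \<Longrightarrow> b k \<in> {0..1::real} \<and> (k \<le> n \<longrightarrow> b k = of_bool (k \<in> B))" and
    eq: "alternating_sum q a = alternating_sum q b"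
    unfolding mem_cyl_interval_iff by metis
  define k where "k = (LEAST k. (k \<in> A) \<noteq> (k \<in> B))"
  have "\<exists>k. (k \<in> A) \<noteq> (k \<in> B)" using assms(3) by blast
  then have k: "(k \<in> A) \<noteq> (k \<in> B)" and least: "\<And>j. j < k \<Longrightarrow> (j \<in> A) = (j \<in> B)"
    unfolding k_def by (fact LeastI_ex, blast dest: not_less_Least)
  have k_range: "1 \<le> k" "k \<le> n" using k assms(1,2) by auto
  have "alternating_sum q a \<noteq> alternating_sum q b"
  proof (rule alternating_sum_neq)
    show "\<bar>a k - b k\<bar> = 1"
      using a[OF k_range(1)] b[OF k_range(1)] k k_range by auto
    show "a j = b j" if "1 \<le> j" "j < k" for j
      using a[OF that(1)] b[OF that(1)] least[OF that(2)] that k_range by auto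
  qed (use a b k_range in auto)
  with eq show False by simp
qed

end

section \<open>Weights of words\<close>

definition word_weight :: "(nat \<Rightarrow> real) \<Rightarrow> (nat \<Rightarrow> real) \<Rightarrow> nat \<Rightarrow> nat set \<Rightarrow> real" where
  "word_weight p0 p1 n A = (\<Prod>k\<in>A. p1 k) * (\<Prod>k\<in>{1..n} - A. p0 k)"

lemma sum_word_weight:
  "(\<Sum>A\<in>Pow {1..n}. word_weight p0 p1 n A) = (\<Prod>k=1..n. p1 k + p0 k)"
  unfolding word_weight_def by (simp add: prod_add)

lemma word_weight_eq_prod:
  assumes "A \<subseteq> {1..n}"
  shows "word_weight p0 p1 n A = (\<Prod>k=1..n. if k \<in> A then p1 k else p0 k)"
proof -
  have "(\<Prod>k=1..n. if k \<in> A then p1 k else p0 k)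
      = (\<Prod>k\<in>A. if k \<in> A then p1 k else p0 k) * (\<Prod>k\<in>{1..n} - A. if k \<in> A then p1 k else p0 k)"
    using prod.subset_diff[OF assms, of "\<lambda>k. if k \<in> A then p1 k else p0 k"]
    by (simp add: mult.commute)
  then show ?thesis by (simp add: word_weight_def)
qed

lemma word_weight_nonneg:
  assumes "A \<subseteq> {1..n}" "\<And>k. 1 \<le> k \<Longrightarrow> 0 \<le> p0 k \<and> 0 \<le> p1 k"
  shows "0 \<le> word_weight p0 p1 n A"
  unfolding word_weight_eq_prod[OF assms(1)] using assms(2) by (intro prod_nonneg) auto

lemma sum_word_weight_powr_le:
  assumes p: "\<And>k. 1 \<le> k \<Longrightarrow> 0 \<le> p0 k \<and> 0 \<le> p1 k \<and> p0 k + p1 k = 1"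
    and s: "\<bar>s\<bar> \<le> 1 / 2"
  defines "h \<equiv> \<lambda>k. binary_entropy (p0 k) (p1 k)"
  shows "(\<Sum>A\<in>Pow {1..n}. word_weight p0 p1 n A powr (1 - s))
           \<le> exp (s * (\<Sum>k=1..n. h k) + 16 * s\<^sup>2 * card {k \<in> {1..n}. 0 < h k})"
proof -
  have "(\<Sum>A\<in>Pow {1..n}. word_weight p0 p1 n A powr (1 - s))
      = (\<Sum>A\<in>Pow {1..n}. word_weight (\<lambda>k. p0 k powr (1 - s)) (\<lambda>k. p1 k powr (1 - s)) n A)"
    by (intro sum.cong) (auto simp: word_weight_def prod_powr_distrib powr_mult)
  also have "\<dots> = (\<Prod>k=1..n. p1 k powr (1 - s) + p0 k powr (1 - s))"
    by (rule sum_word_weight)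
  also have "\<dots> \<le> (\<Prod>k=1..n. exp (s * h k + 16 * s\<^sup>2 * of_bool (0 < h k)))"
  proof (intro prod_mono conjI)
    fix k assume "k \<in> {1..n}"
    then show "p1 k powr (1 - s) + p0 k powr (1 - s) \<le> exp (s * h k + 16 * s\<^sup>2 * of_bool (0 < h k))"
      using sum_powr_tilt_le_exp[of "p0 k" "p1 k" s] p[of k] s by (simp add: h_def add.commute)
  qed simp
  also have "\<dots> = exp (s * (\<Sum>k=1..n. h k) + 16 * s\<^sup>2 * card {k \<in> {1..n}. 0 < h k})"
  proof -
    have "(\<Sum>k=1..n. of_bool (0 < h k) :: real) = card {k \<in> {1..n}. 0 < h k}"
      by (subst sum_of_bool_eq) (auto intro!: arg_cong[of _ _ card])
    then show ?thesis
      by (simp add: sum.distrib flip: exp_sum sum_distrib_left)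
  qed
  finally show ?thesis .
qed

text \<open>
  A Chernoff bound in combinatorial form: on the words in question one writes the weight as its
  power \<open>1 - s\<close> times its power \<open>s\<close> and estimates the latter, so that the sum over all words
  factorises into the one-digit sums. Positive \<open>s\<close> treats words of too small weight, negative
  \<open>s\<close> words of too large weight.
\<close>

lemma sum_word_weight_deviation_le:
  assumes p: "\<And>k. 1 \<le> k \<Longrightarrow> 0 \<le> p0 k \<and> 0 \<le> p1 k \<and> p0 k + p1 k = 1"
    and s: "\<bar>s\<bar> \<le> 1 / 2"
    and W: "W \<subseteq> Pow {1..n}" "\<And>A. A \<in> W \<Longrightarrow> word_weight p0 p1 n A powr s \<le> exp (- x)"
  defines "h \<equiv> \<lambda>k. binary_entropy (p0 k) (p1 k)"
  shows "(\<Sum>A\<in>W. word_weight p0 p1 n A)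
           \<le> exp (s * (\<Sum>k=1..n. h k) + 16 * s\<^sup>2 * card {k \<in> {1..n}. 0 < h k} - x)"
proof -
  let ?w = "word_weight p0 p1 n"
  have "(\<Sum>A\<in>W. ?w A) \<le> (\<Sum>A\<in>W. ?w A powr (1 - s) * exp (- x))"
  proof (rule sum_mono)
    fix A assume A: "A \<in> W"
    then have "0 \<le> ?w A" using W(1) p by (intro word_weight_nonneg) auto
    then have "?w A = ?w A powr (1 - s) * ?w A powr s"
      by (simp flip: powr_add)
    also have "\<dots> \<le> ?w A powr (1 - s) * exp (- x)"
      using W(2)[OF A] by (intro mult_left_mono) auto
    finally show "?w A \<le> ?w A powr (1 - s) * exp (- x)" .
  qed
  also have "\<dots> \<le> (\<Sum>A\<in>Pow {1..n}. ?w A powr (1 - s) * exp (- x))"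
    using W(1) by (intro sum_mono2) auto
  also have "\<dots> = (\<Sum>A\<in>Pow {1..n}. ?w A powr (1 - s)) * exp (- x)"
    by (simp add: sum_distrib_right)
  also have "\<dots> \<le> exp (s * (\<Sum>k=1..n. h k) + 16 * s\<^sup>2 * card {k \<in> {1..n}. 0 < h k}) * exp (- x)"
    unfolding h_def using p s by (intro mult_right_mono sum_word_weight_powr_le) auto
  finally show ?thesis by (simp add: exp_diff exp_minus field_simps)
qed

section \<open>Distributions of random alternating sums\<close>

lemma borel_cyl_interval [measurable, simp]: "cyl_interval q n A \<in> sets borel"
  by (simp add: cyl_interval_def)

lemma (in fast_growth) cyl_interval_subset: "cyl_interval q n A \<subseteq> cyl_interval q 0 {}"
  unfolding subset_iff mem_cyl_interval_iff by (metis le_zero_eq not_one_le_zero)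

lemma (in fast_growth) card_cyl_intervals_through_le_1:
  "card {A \<in> Pow {1..n}. x \<in> cyl_interval q n A} \<le> 1"
proof -
  have "A = B" if "A \<subseteq> {1..n}" "B \<subseteq> {1..n}" "x \<in> cyl_interval q n A" "x \<in> cyl_interval q n B" for A B
    using cyl_intervals_disjoint[of A n B] that by blast
  then show ?thesis by (subst card_le_Suc0_iff_eq[simplified One_nat_def[symmetric]]) auto
qed

text \<open>
  All that the dimension argument needs to know about the law of a random alternating sum with
  independent digits is the mass of each cylinder interval.
\<close>

locale digit_distribution = fast_growth q + prob_space \<mu>
  for q :: "nat \<Rightarrow> nat" and \<mu> :: "real measure" +
  fixes p0 p1 :: "nat \<Rightarrow> real"
  assumes p_nonneg: "\<And>k. 1 \<le> k \<Longrightarrow> 0 \<le> p0 k \<and> 0 \<le> p1 k"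
    and p_sum: "\<And>k. 1 \<le> k \<Longrightarrow> p0 k + p1 k = 1"
    and sets_eq_borel [simp, measurable_cong]: "sets \<mu> = sets borel"
    and measure_cyl: "\<And>n A. A \<subseteq> {1..n} \<Longrightarrow> measure \<mu> (cyl_interval q n A) = word_weight p0 p1 n A"
begin

lemma space_eq_UNIV [simp]: "space \<mu> = UNIV"
  using sets_eq_imp_space_eq[OF sets_eq_borel] by simp

lemma measure_Union_cyl:
  assumes "W \<subseteq> Pow {1..n}"
  shows "measure \<mu> (\<Union>A\<in>W. cyl_interval q n A) = (\<Sum>A\<in>W. word_weight p0 p1 n A)"
proof -
  have "measure \<mu> (\<Union>A\<in>W. cyl_interval q n A) = (\<Sum>A\<in>W. measure \<mu> (cyl_interval q n A))"
  proof (rule finite_measure_finite_Union)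
    show "finite W" using assms finite_subset by blast
    show "disjoint_family_on (cyl_interval q n) W"
      using cyl_intervals_disjoint assms unfolding disjoint_family_on_def by blast
  qed auto
  also have "\<dots> = (\<Sum>A\<in>W. word_weight p0 p1 n A)"
    using assms by (intro sum.cong measure_cyl) auto
  finally show ?thesis .
qed

lemma sum_word_weight_eq_1: "(\<Sum>A\<in>Pow {1..n}. word_weight p0 p1 n A) = 1"
  unfolding sum_word_weight using p_sum by (intro prod.neutral) (auto simp: add.commute)

text \<open>
  The cylinder intervals of any fixed rank carry the whole mass, because the weights of the words
  sum to \<open>1\<close>. A set is therefore no heavier than the cylinder intervals that it meets.
\<close>

lemma measure_le_sum_met:
  assumes J: "J \<in> sets borel"
  shows "measure \<mu> J \<le> (\<Sum>A | A \<subseteq> {1..n} \<and> cyl_interval q n A \<inter> J \<noteq> {} \<and> word_weight p0 p1 n A \<noteq> 0.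
           word_weight p0 p1 n A)"
proof -
  let ?W = "{A. A \<subseteq> {1..n} \<and> cyl_interval q n A \<inter> J \<noteq> {}}"
  let ?U = "\<Union>A\<in>Pow {1..n}. cyl_interval q n A"
  have fin: "finite ?W" by (rule finite_subset[of _ "Pow {1..n}"]) auto
  have U: "?U \<in> sets borel" "(\<Union>A\<in>?W. cyl_interval q n A) \<in> sets borel"
    using fin by (auto intro!: sets.finite_UN)
  have "measure \<mu> ?U = 1"
    by (subst measure_Union_cyl[OF order_refl]) (rule sum_word_weight_eq_1)
  then have null: "measure \<mu> (UNIV - ?U) = 0"
    using prob_compl[of ?U] U by simp
  have "measure \<mu> J \<le> measure \<mu> ((\<Union>A\<in>?W. cyl_interval q n A) \<union> (UNIV - ?U))"
  proof (rule finite_measure_mono)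
    show "J \<subseteq> (\<Union>A\<in>?W. cyl_interval q n A) \<union> (UNIV - ?U)" by blast
    show "(\<Union>A\<in>?W. cyl_interval q n A) \<union> (UNIV - ?U) \<in> sets \<mu>"
      unfolding sets_eq_borel using U by (intro sets.Un borel_comp[unfolded Compl_eq_Diff_UNIV])
  qed
  also have "\<dots> \<le> measure \<mu> (\<Union>A\<in>?W. cyl_interval q n A) + measure \<mu> (UNIV - ?U)"
    using U by (intro measure_Un_le) auto
  also have "\<dots> = (\<Sum>A\<in>?W. word_weight p0 p1 n A)"
    using null by (subst measure_Union_cyl) auto
  also have "\<dots> = (\<Sum>A | A \<subseteq> {1..n} \<and> cyl_interval q n A \<inter> J \<noteq> {} \<and> word_weight p0 p1 n A \<noteq> 0.
           word_weight p0 p1 n A)"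
    using fin by (intro sum.mono_neutral_right) auto
  finally show ?thesis .
qed

end

text \<open>
  Almost surely all digits are \<open>0\<close> or \<open>1\<close>, and then the sum lies in the cylinder interval of its
  own first \<open>n\<close> digits and, by disjointness, in no other one of rank \<open>n\<close>. So the mass of a
  cylinder interval is the probability of a word, which is a product by independence.
\<close>

lemma (in fast_growth) digit_distribution_distr:
  assumes M: "prob_space M" and indep: "prob_space.indep_vars M (\<lambda>_. borel) \<xi> {1..}"
    and p: "\<And>k. 1 \<le> k \<Longrightarrow> p0 k + p1 k = (1 :: real)"
    and \<xi>_0: "\<And>k. 1 \<le> k \<Longrightarrow> measure M {\<omega> \<in> space M. \<xi> k \<omega> = 0} = p0 k"
    and \<xi>_1: "\<And>k. 1 \<le> k \<Longrightarrow> measure M {\<omega> \<in> space M. \<xi> k \<omega> = 1} = p1 k"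
  shows "digit_distribution q (distr M borel (\<lambda>\<omega>. alternating_sum q (\<lambda>k. \<xi> k \<omega>))) p0 p1"
proof -
  interpret prob_space M by (rule M)
  let ?X = "\<lambda>\<omega>. alternating_sum q (\<lambda>k. \<xi> k \<omega>)"
  have rv: "\<xi> k \<in> borel_measurable M" if "1 \<le> k" for k
    using indep that unfolding indep_vars_def by auto
  have rv_Suc [measurable]: "\<xi> (Suc k) \<in> borel_measurable M" for k
    by (rule rv) simp
  have X [measurable]: "?X \<in> borel_measurable M"
    unfolding alternating_sum_def by measurable
  have ae_digit: "AE \<omega> in M. \<xi> (Suc k) \<omega> = 0 \<or> \<xi> (Suc k) \<omega> = 1" for k
  proof (rule AE_I_eq_1)
    have "prob {\<omega> \<in> space M. \<xi> (Suc k) \<omega> = 0 \<or> \<xi> (Suc k) \<omega> = 1}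
        = prob ({\<omega> \<in> space M. \<xi> (Suc k) \<omega> = 0} \<union> {\<omega> \<in> space M. \<xi> (Suc k) \<omega> = 1})"
      by (intro arg_cong[of _ _ prob]) auto
    also have "\<dots> = p0 (Suc k) + p1 (Suc k)"
      by (subst finite_measure_Union) (auto simp: \<xi>_0 \<xi>_1)
    finally show "emeasure M {\<omega> \<in> space M. \<xi> (Suc k) \<omega> = 0 \<or> \<xi> (Suc k) \<omega> = 1} = 1"
      using p[of "Suc k"] by (simp add: emeasure_eq_measure)
  qed measurable
  have ae_digits: "AE \<omega> in M. \<forall>k\<ge>1. \<xi> k \<omega> = 0 \<or> \<xi> k \<omega> = 1"
  proof -
    have "AE \<omega> in M. \<forall>k. \<xi> (Suc k) \<omega> = 0 \<or> \<xi> (Suc k) \<omega> = 1"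
      using ae_digit by (subst AE_all_countable) blast
    then show ?thesis
    proof eventually_elim
      case (elim \<omega>)
      show ?case
      proof (intro allI impI)
        fix k :: nat assume "1 \<le> k"
        then show "\<xi> k \<omega> = 0 \<or> \<xi> k \<omega> = 1" using elim[rule_format, of "k - 1"] by simp
      qed
    qed
  qed
  have weight: "measure (distr M borel ?X) (cyl_interval q n A) = word_weight p0 p1 n A"
    if A: "A \<subseteq> {1..n}" for n A
  proof -
    let ?D = "{\<omega> \<in> space M. \<forall>k\<in>{1..n}. \<xi> k \<omega> = of_bool (k \<in> A)}"
    have rvn: "\<xi> k \<in> borel_measurable M" if "k \<in> {1..n}" for k
      using rv that by auto
    have D: "?D \<in> sets M"
      using rvn by measurable
    have "measure (distr M borel ?X) (cyl_interval q n A) = prob {\<omega> \<in> space M. ?X \<omega> \<in> cyl_interval q n A}"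
      by (subst measure_distr) (auto intro!: arg_cong[of _ _ prob])
    also have "\<dots> = prob ?D"
    proof (rule finite_measure_eq_AE)
      show "AE \<omega> in M. (\<omega> \<in> {\<omega> \<in> space M. ?X \<omega> \<in> cyl_interval q n A}) = (\<omega> \<in> ?D)"
        using ae_digits
      proof eventually_elim
        case (elim \<omega>)
        let ?B = "{k \<in> {1..n}. \<xi> k \<omega> = 1}"
        have B: "?X \<omega> \<in> cyl_interval q n ?B"
          unfolding mem_cyl_interval_iff
          by (rule exI[of _ "\<lambda>k. \<xi> k \<omega>"]) (use elim in fastforce)
        have "?X \<omega> \<in> cyl_interval q n A \<longleftrightarrow> A = ?B"
        proof
          show "A = ?B" if "?X \<omega> \<in> cyl_interval q n A"
            using B that cyl_intervals_disjoint[OF A, of ?B] by blast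
        next
          assume "A = ?B"
          with B show "?X \<omega> \<in> cyl_interval q n A" by (simp only:)
        qed
        also have "\<dots> \<longleftrightarrow> (\<forall>k\<in>{1..n}. \<xi> k \<omega> = of_bool (k \<in> A))"
        proof -
          have "(k \<in> A \<longleftrightarrow> \<xi> k \<omega> = 1) \<longleftrightarrow> \<xi> k \<omega> = of_bool (k \<in> A)" if "k \<in> {1..n}" for k
            using elim that by (cases "k \<in> A") auto
          moreover have "A = ?B \<longleftrightarrow> (\<forall>k\<in>{1..n}. k \<in> A \<longleftrightarrow> \<xi> k \<omega> = 1)"
            using A by blast
          ultimately show ?thesis by blast
        qed
        finally show ?case by simp
      qed
    qed (use D in \<open>auto\<close>)
    also have "\<dots> = word_weight p0 p1 n A"
    proof (cases "n = 0")
      case True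
      with A show ?thesis by (simp add: word_weight_def prob_space)
    next
      case False
      then have ne: "{1..n} \<noteq> {}" by simp
      have "?D = (\<Inter>k\<in>{1..n}. \<xi> k -` {of_bool (k \<in> A)} \<inter> space M)"
        using ne by auto
      then have "prob ?D = (\<Prod>k=1..n. prob (\<xi> k -` {of_bool (k \<in> A)} \<inter> space M))"
        using ne by (simp only:) (rule indep_varsD[OF indep], auto)
      also have "\<dots> = (\<Prod>k=1..n. if k \<in> A then p1 k else p0 k)"
        by (intro prod.cong) (auto simp: vimage_def Int_def conj_commute \<xi>_0[symmetric] \<xi>_1[symmetric])
      also have "\<dots> = word_weight p0 p1 n A"
        by (rule word_weight_eq_prod[OF A, symmetric])
      finally show ?thesis .
    qed
    finally show ?thesis .
  qed
  interpret D: prob_space "distr M borel ?X" by (rule prob_space_distr[OF X])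
  show ?thesis
  proof unfold_locales
    show "0 \<le> p0 k \<and> 0 \<le> p1 k" if "1 \<le> k" for k
      using \<xi>_0[OF that] \<xi>_1[OF that] by (metis measure_nonneg)
  qed (simp_all add: p weight)
qed

section \<open>Coverings in the Hausdorff--Billingsley measure\<close>

lemma hausdorff_billingsley_measure_eq_0I:
  assumes "\<And>\<epsilon> \<eta>. 0 < \<epsilon> \<Longrightarrow> 0 < \<eta> \<Longrightarrow> hausdorff_billingsley_pre \<alpha> \<epsilon> E \<nu> \<le> ennreal \<eta>"
  shows "hausdorff_billingsley_measure \<alpha> E \<nu> = 0"
proof -
  have "hausdorff_billingsley_pre \<alpha> \<epsilon> E \<nu> \<le> 0" if "0 < \<epsilon>" for \<epsilon>
    by (rule ennreal_le_epsilon) (simp add: assms that)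
  then show ?thesis
    unfolding hausdorff_billingsley_measure_eq_SUP by (simp add: SUP_eq_iff cong: SUP_cong)
qed

lemma hausdorff_billingsley_pre_eq_0D:
  assumes "hausdorff_billingsley_measure \<alpha> E \<nu> = 0" "0 < \<epsilon>"
  shows "hausdorff_billingsley_pre \<alpha> \<epsilon> E \<nu> = 0"
proof -
  have "hausdorff_billingsley_pre \<alpha> \<epsilon> E \<nu> \<le> hausdorff_billingsley_measure \<alpha> E \<nu>"
    unfolding hausdorff_billingsley_measure_eq_SUP using assms(2) by (intro SUP_upper) auto
  with assms(1) show ?thesis by simp
qed

lemma hausdorff_billingsley_pre_le_double_cover:
  fixes C :: "nat \<Rightarrow> nat \<Rightarrow> real set"
  assumes "\<And>i j. \<exists>a b. C i j = {a..b}" "\<And>i j. measure \<nu> (C i j) \<le> \<epsilon>" "E \<subseteq> (\<Union>i j. C i j)"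
  shows "hausdorff_billingsley_pre \<alpha> \<epsilon> E \<nu> \<le> (\<Sum>i. \<Sum>j. ennreal (measure \<nu> (C i j) powr \<alpha>))"
proof -
  let ?D = "\<lambda>k. case prod_decode k of (i, j) \<Rightarrow> C i j"
  have "E \<subseteq> (\<Union>k. ?D k)"
  proof
    fix x assume "x \<in> E"
    then obtain i j where "x \<in> C i j" using assms(3) by blast
    then show "x \<in> (\<Union>k. ?D k)" by (intro UN_I[of "prod_encode (i, j)"]) auto
  qed
  then have "?D \<in> interval_coverings \<nu> \<epsilon> E"
    using assms(1,2) by (auto simp: interval_coverings_def split: prod.split)
  then have "hausdorff_billingsley_pre \<alpha> \<epsilon> E \<nu> \<le> (\<Sum>k. ennreal (measure \<nu> (?D k) powr \<alpha>))"
    unfolding hausdorff_billingsley_pre_def by (rule INF_lower)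
  also have "\<dots> = (\<Sum>k. (\<lambda>(i, j). ennreal (measure \<nu> (C i j) powr \<alpha>)) (prod_decode k))"
    by (intro suminf_cong) (auto split: prod.split)
  also have "\<dots> = (\<Sum>i. \<Sum>j. ennreal (measure \<nu> (C i j) powr \<alpha>))"
    by (rule suminf_ennreal_2dimen) simp
  finally show ?thesis .
qed

section \<open>Comparison with the uniform distribution on the spectrum\<close>

locale uniform_comparison =
  mu: digit_distribution q \<mu> p0 p1 +
  nu: digit_distribution q \<nu> "\<lambda>k. uniform_weight (p0 k)" "\<lambda>k. uniform_weight (p1 k)"
  for q :: "nat \<Rightarrow> nat" and \<mu> \<nu> :: "real measure" and p0 p1 :: "nat \<Rightarrow> real" +
  assumes p_inf: "infinite {k. 1 \<le> k \<and> max (p0 k) (p1 k) < 1}"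
begin

definition h :: "nat \<Rightarrow> real" where "h k = binary_entropy (p0 k) (p1 k)"
definition H :: "nat \<Rightarrow> real" where "H n = (\<Sum>k=1..n. h k)"
definition g :: "nat \<Rightarrow> nat" where "g n = card {k \<in> {1..n}. 0 < h k}"

abbreviation w :: "nat \<Rightarrow> nat set \<Rightarrow> real" where "w \<equiv> word_weight p0 p1"
abbreviation cyl :: "nat \<Rightarrow> nat set \<Rightarrow> real set" where "cyl \<equiv> cyl_interval q"

lemma h_pos_iff: assumes "1 \<le> k" shows "0 < h k \<longleftrightarrow> p0 k \<noteq> 0 \<and> p1 k \<noteq> 0"
  unfolding h_def using mu.p_nonneg[OF assms] mu.p_sum[OF assms] by (intro binary_entropy_pos_iff) auto

lemma h_nonneg: assumes "1 \<le> k" shows "0 \<le> h k"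
  unfolding h_def using mu.p_nonneg[OF assms] mu.p_sum[OF assms] by (intro binary_entropy_nonneg) auto

lemma H_nonneg: "0 \<le> H n"
  unfolding H_def by (intro sum_nonneg h_nonneg) simp

lemma g_mono: "m \<le> n \<Longrightarrow> g m \<le> g n"
  unfolding g_def by (intro card_mono) auto

lemma g_Suc_le: "g (Suc n) \<le> Suc (g n)"
proof -
  have "{k \<in> {1..Suc n}. 0 < h k} \<subseteq> insert (Suc n) {k \<in> {1..n}. 0 < h k}" by (auto simp: le_Suc_eq)
  then have "g (Suc n) \<le> card (insert (Suc n) {k \<in> {1..n}. 0 < h k})"
    unfolding g_def by (intro card_mono) auto
  also have "\<dots> \<le> Suc (g n)"
    unfolding g_def by (simp add: card_insert_if)
  finally show ?thesis .
qed

lemma g_unbounded: "\<exists>n. m \<le> g n"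
proof -
  have "{k. 1 \<le> k \<and> max (p0 k) (p1 k) < 1} \<subseteq> {k. 1 \<le> k \<and> 0 < h k}"
  proof clarify
    fix k assume k: "1 \<le> k" "max (p0 k) (p1 k) < 1"
    then show "0 < h k" unfolding h_pos_iff[OF k(1)] using mu.p_sum[OF k(1)] by auto
  qed
  then have "infinite {k. 1 \<le> k \<and> 0 < h k}"
    using p_inf finite_subset by blast
  then obtain B where B: "B \<subseteq> {k. 1 \<le> k \<and> 0 < h k}" "finite B" "card B = m"
    using infinite_arbitrarily_large by metis
  have "B \<subseteq> {k \<in> {1..\<Sum>B}. 0 < h k}"
    using B(1) member_le_sum[of _ B "\<lambda>k. k"] B(2) by auto
  then have "m \<le> g (\<Sum>B)"
    unfolding g_def B(3)[symmetric] by (intro card_mono) auto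
  then show ?thesis ..
qed

text \<open>
  Since \<open>g\<close> starts at \<open>0\<close>, grows in unit steps and is unbounded, it takes every value. Hence there
  is a rank at which the admissible cylinder intervals have \<open>\<nu>\<close>-mass exactly \<open>2\<close> to the power
  \<open>- m\<close>, for every \<open>m\<close>.
\<close>

lemma ex_g_eq: "\<exists>n. g n = m"
proof -
  define n where "n = (LEAST n. m \<le> g n)"
  have ge: "m \<le> g n" and least: "\<And>j. j < n \<Longrightarrow> g j < m"
    unfolding n_def using g_unbounded[of m] by (auto intro: LeastI_ex dest: not_less_Least)
  have "g n = m"
  proof (cases n)
    case 0
    then show ?thesis using ge by (simp add: g_def)
  next
    case (Suc j)
    then show ?thesis using ge least[of j] g_Suc_le[of j] by simp
  qed
  then show ?thesis ..
qed

text \<open>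
  The words that are possible under \<open>\<mu>\<close> are also those possible under \<open>\<nu>\<close>, and under \<open>\<nu>\<close> each
  nondeterministic digit is a fair coin.
\<close>

lemma measure_nu_cyl:
  assumes "A \<subseteq> {1..n}"
  shows "measure \<nu> (cyl n A) = (if w n A = 0 then 0 else (1 / 2) ^ g n)"
proof -
  let ?p = "\<lambda>k. if k \<in> A then p1 k else p0 k"
  let ?u = "\<lambda>k. if k \<in> A then uniform_weight (p1 k) else uniform_weight (p0 k)"
  have nu: "measure \<nu> (cyl n A) = (\<Prod>k=1..n. ?u k)"
    using assms by (simp add: nu.measure_cyl word_weight_eq_prod)
  have w: "w n A = (\<Prod>k=1..n. ?p k)"
    by (rule word_weight_eq_prod[OF assms])
  show ?thesis
  proof (cases "w n A = 0")
    case True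
    then obtain k where "k \<in> {1..n}" "?p k = 0" unfolding w by auto
    then have "?u k = 0" by (auto simp: uniform_weight_def split: if_splits)
    with \<open>k \<in> {1..n}\<close> have "\<exists>k\<in>{1..n}. ?u k = 0" by blast
    then show ?thesis using True unfolding nu by (simp add: prod_zero)
  next
    case False
    then have p: "?p k \<noteq> 0" if "k \<in> {1..n}" for k using that unfolding w by auto
    have "(\<Prod>k=1..n. ?u k) = (\<Prod>k=1..n. if 0 < h k then 1 / 2 else 1)"
    proof (rule prod.cong)
      fix k assume k: "k \<in> {1..n}"
      then have 1: "1 \<le> k" by simp
      show "?u k = (if 0 < h k then 1 / 2 else 1)"
        unfolding h_pos_iff[OF 1] using p[OF k] mu.p_sum[OF 1] by (auto simp: uniform_weight_def)
    qed simp
    also have "\<dots> = (\<Prod>k | k \<in> {1..n} \<and> 0 < h k. 1 / 2)"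
      by (rule prod.inter_filter[symmetric]) simp
    also have "\<dots> = (1 / 2) ^ g n"
      by (simp add: g_def)
    finally show ?thesis using False nu by simp
  qed
qed

lemma measure_nu_cyl_le: "A \<subseteq> {1..n} \<Longrightarrow> measure \<nu> (cyl n A) \<le> (1 / 2) ^ g n"
  by (simp add: measure_nu_cyl)

lemma sum_w_deviation_le:
  assumes "\<bar>s\<bar> \<le> 1 / 2" "W \<subseteq> Pow {1..n}" "\<And>A. A \<in> W \<Longrightarrow> w n A powr s \<le> exp (- x)"
  shows "(\<Sum>A\<in>W. w n A) \<le> exp (s * H n + 16 * s\<^sup>2 * g n - x)"
  using sum_word_weight_deviation_le[of p0 p1 s W n x] mu.p_nonneg mu.p_sum assms
  by (simp add: H_def g_def h_def)

text \<open>
  By the law of large numbers the weight of a typical word of length \<open>n\<close> is about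
  \<open>exp (- H n)\<close>, with an error in the exponent that is small compared with \<open>g n\<close>. The upper bound
  for the dimension needs typical words to be heavy, since there are then few of them; the lower
  bound needs them not to be too heavy.
\<close>

definition frequent_words :: "real \<Rightarrow> nat \<Rightarrow> nat set set" where
  "frequent_words \<delta> n = {A. A \<subseteq> {1..n} \<and> exp (- (H n + \<delta> * g n)) \<le> w n A}"

definition too_frequent_words :: "real \<Rightarrow> nat \<Rightarrow> nat set set" where
  "too_frequent_words \<delta> n = {A. A \<subseteq> {1..n} \<and> exp (- (H n - \<delta> * g n)) < w n A}"

lemma finite_words: "finite (frequent_words \<delta> n)" "finite (too_frequent_words \<delta> n)"
  by (rule finite_subset[of _ "Pow {1..n}"]; auto simp: frequent_words_def too_frequent_words_def)+

text \<open>
  The exponent \<open>s * \<delta> - 16 * s\<^sup>2\<close> of the Chernoff bound would be maximal at \<open>s = \<delta> / 32\<close>; the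
  minimum respects the constraint \<open>s \<le> 1 / 2\<close>, and for either value the exponent is at least
  \<open>s * \<delta> / 2\<close>.
\<close>

definition rate :: "real \<Rightarrow> real" where "rate \<delta> = min (1 / 2) (\<delta> / 32) * \<delta> / 2"

lemma rate_pos: "0 < \<delta> \<Longrightarrow> 0 < rate \<delta>"
  by (simp add: rate_def)

lemma deviation_rate:
  assumes "0 < \<delta>"
  defines "s \<equiv> min (1 / 2) (\<delta> / 32)"
  shows "0 < s" "s \<le> 1 / 2" "16 * s\<^sup>2 * real m - s * \<delta> * real m \<le> - (rate \<delta> * real m)"
proof -
  show s: "0 < s" "s \<le> 1 / 2" using assms by (auto simp: s_def)
  have "s * (16 * s) \<le> s * (\<delta> / 2)"
    using s by (intro mult_left_mono) (auto simp: s_def)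
  then have "16 * s\<^sup>2 - s * \<delta> \<le> - rate \<delta>"
    unfolding rate_def s_def[symmetric] by (simp add: power2_eq_square)
  then have "(16 * s\<^sup>2 - s * \<delta>) * real m \<le> - rate \<delta> * real m"
    by (rule mult_right_mono) simp
  then show "16 * s\<^sup>2 * real m - s * \<delta> * real m \<le> - (rate \<delta> * real m)"
    by (simp add: algebra_simps)
qed

lemma sum_infrequent_words_le:
  assumes "0 < \<delta>"
  shows "(\<Sum>A\<in>Pow {1..n} - frequent_words \<delta> n. w n A) \<le> exp (- (rate \<delta> * g n))"
proof -
  define s where "s = min (1 / 2) (\<delta> / 32)"
  note s = deviation_rate[OF assms, folded s_def]
  have "(\<Sum>A\<in>Pow {1..n} - frequent_words \<delta> n. w n A)
      \<le> exp (s * H n + 16 * s\<^sup>2 * g n - s * (H n + \<delta> * g n))"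
  proof (rule sum_w_deviation_le)
    fix A assume A: "A \<in> Pow {1..n} - frequent_words \<delta> n"
    then have "0 \<le> w n A" using mu.p_nonneg by (intro word_weight_nonneg) auto
    then have "w n A powr s \<le> exp (- (H n + \<delta> * g n)) powr s"
      using A s by (intro powr_mono2) (auto simp: frequent_words_def)
    then show "w n A powr s \<le> exp (- (s * (H n + \<delta> * g n)))"
      by (simp add: exp_powr_real algebra_simps)
  qed (use s in auto)
  also have "\<dots> \<le> exp (- (rate \<delta> * g n))"
    using s(3)[of "g n"] by (simp add: algebra_simps)
  finally show ?thesis .
qed

lemma sum_too_frequent_words_le:
  assumes "0 < \<delta>"
  shows "(\<Sum>A\<in>too_frequent_words \<delta> n. w n A) \<le> exp (- (rate \<delta> * g n))"
proof -
  define s where "s = min (1 / 2) (\<delta> / 32)"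
  note s = deviation_rate[OF assms, folded s_def]
  have "(\<Sum>A\<in>too_frequent_words \<delta> n. w n A)
      \<le> exp (- s * H n + 16 * (- s)\<^sup>2 * g n - - s * (H n - \<delta> * g n))"
  proof (rule sum_w_deviation_le)
    fix A assume A: "A \<in> too_frequent_words \<delta> n"
    then have "w n A powr - s \<le> exp (- (H n - \<delta> * g n)) powr - s"
      using s by (intro powr_mono2') (auto simp: too_frequent_words_def)
    then show "w n A powr - s \<le> exp (- (- s * (H n - \<delta> * g n)))"
      by (simp add: exp_powr_real algebra_simps)
  qed (use s in \<open>auto simp: too_frequent_words_def\<close>)
  also have "\<dots> \<le> exp (- (rate \<delta> * g n))"
    using s(3)[of "g n"] by (simp add: algebra_simps)
  finally show ?thesis .
qed

lemma card_frequent_words_le: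
  fixes \<delta> :: real
  shows "card (frequent_words \<delta> n) \<le> exp (H n + \<delta> * g n)"
proof -
  have "card (frequent_words \<delta> n) * exp (- (H n + \<delta> * g n))
      = (\<Sum>A\<in>frequent_words \<delta> n. exp (- (H n + \<delta> * g n)))"
    by simp
  also have "\<dots> \<le> (\<Sum>A\<in>frequent_words \<delta> n. w n A)"
    by (intro sum_mono) (auto simp: frequent_words_def)
  also have "\<dots> \<le> (\<Sum>A\<in>Pow {1..n}. w n A)"
    using mu.p_nonneg by (intro sum_mono2 word_weight_nonneg) (auto simp: frequent_words_def)
  also have "\<dots> = 1" by (rule mu.sum_word_weight_eq_1)
  finally have "card (frequent_words \<delta> n) / exp (H n + \<delta> * g n) \<le> 1"
    by (simp only: exp_minus divide_inverse)
  then show ?thesis by (simp add: pos_divide_le_eq)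
qed

section \<open>Upper bound for the dimension\<close>

text \<open>
  The witness is the set \<open>E\<close> of the points that lie in infinitely many of the sets \<open>U i\<close>, where
  \<open>U i\<close> is the union of the cylinder intervals of the heavy words at a rank \<open>r i\<close> with small
  entropy quotient. As \<open>\<mu> (U i)\<close> tends to \<open>1\<close>, every tail union of the \<open>U i\<close> has full measure,
  and so does \<open>E\<close>. On the other hand \<open>U i\<close> consists of at most
  \<open>exp (H n + \<delta> * g n)\<close> intervals of \<open>\<nu>\<close>-mass at most \<open>(1 / 2) ^ g n\<close> with \<open>n = r i\<close>, so the
  sums over the tail unions are dominated by the tails of a geometric series.
\<close>

lemma dim_le_of_frequently_less:
  assumes \<beta>: "0 < \<beta>" "\<beta> < \<alpha>"
    and freq: "\<And>N. \<exists>n\<ge>N. H n / (real (g n) * ln 2) < \<beta>"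
  shows "hausdorff_billingsley_dim_measure \<mu> \<nu> \<le> ereal \<alpha>"
proof -
  \<comment> \<open>Half of the gap pays for the number of heavy words, the other half makes the series converge.\<close>
  define \<delta> where "\<delta> = (\<alpha> - \<beta>) * ln 2 / 2"
  have \<delta>: "0 < \<delta>" using \<beta> by (simp add: \<delta>_def)
  have "\<exists>n. i < g n \<and> H n \<le> \<beta> * ln 2 * g n" for i
  proof -
    obtain N where N: "g N = Suc i" using ex_g_eq by blast
    obtain n where n: "N \<le> n" "H n / (real (g n) * ln 2) < \<beta>" using freq by blast
    have "i < g n" using g_mono[OF n(1)] N by simp
    then show ?thesis
      using n(2) by (intro exI[of _ n]) (simp add: pos_divide_less_eq mult.assoc mult.commute mult.left_commute)
  qed
  then obtain r where r: "\<And>i. i < g (r i)" "\<And>i. H (r i) \<le> \<beta> * ln 2 * g (r i)"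
    by metis
  define G where "G i = frequent_words \<delta> (r i)" for i
  define U where "U i = (\<Union>A\<in>G i. cyl (r i) A)" for i
  define E where "E = (\<Inter>k. \<Union>i\<in>{k..}. U i)"
  have G_words: "G i \<subseteq> Pow {1..r i}" and G_fin: "finite (G i)" for i
    by (auto simp: G_def frequent_words_def finite_words)
  have U_borel [measurable]: "U i \<in> sets borel" for i
    unfolding U_def using G_fin by (intro sets.finite_UN) auto
  have E_borel: "E \<in> sets borel"
    unfolding E_def by measurable
  have U_measure: "1 - exp (- rate \<delta>) ^ i \<le> measure \<mu> (U i)" for i
  proof -
    have "measure \<mu> (U i) = (\<Sum>A\<in>G i. w (r i) A)"
      unfolding U_def by (rule mu.measure_Union_cyl[OF G_words])
    also have "\<dots> = 1 - (\<Sum>A\<in>Pow {1..r i} - G i. w (r i) A)"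
      using sum.subset_diff[OF G_words, of i "w (r i)"] mu.sum_word_weight_eq_1[of "r i"] by simp
    also have "\<dots> \<ge> 1 - exp (- (rate \<delta> * g (r i)))"
      unfolding G_def using sum_infrequent_words_le[OF \<delta>] by (intro diff_left_mono)
    finally have "1 - exp (- (rate \<delta> * g (r i))) \<le> measure \<mu> (U i)" .
    moreover have "exp (- (rate \<delta> * g (r i))) \<le> exp (- (rate \<delta> * i))"
      using rate_pos[OF \<delta>] r(1)[of i] by simp
    moreover have "exp (- (rate \<delta> * i)) = exp (- rate \<delta>) ^ i"
      by (simp flip: exp_of_nat_mult add: mult.commute)
    ultimately show ?thesis by linarith
  qed
  have V_measure: "measure \<mu> (\<Union>i\<in>{k..}. U i) = 1" for k
  proof (rule antisym)
    have "(\<lambda>i. 1 - exp (- rate \<delta>) ^ i) \<longlonglongrightarrow> 1 - 0"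
      using rate_pos[OF \<delta>] by (intro tendsto_intros LIMSEQ_power_zero) auto
    moreover have "\<exists>N. \<forall>i\<ge>N. 1 - exp (- rate \<delta>) ^ i \<le> measure \<mu> (\<Union>i\<in>{k..}. U i)"
    proof (intro exI allI impI)
      fix i assume "k \<le> i"
      then have "measure \<mu> (U i) \<le> measure \<mu> (\<Union>i\<in>{k..}. U i)"
        by (intro mu.finite_measure_mono) (auto intro!: sets.countable_UN')
      with U_measure[of i] show "1 - exp (- rate \<delta>) ^ i \<le> measure \<mu> (\<Union>i\<in>{k..}. U i)"
        by linarith
    qed
    ultimately show "1 \<le> measure \<mu> (\<Union>i\<in>{k..}. U i)"
      using LIMSEQ_le_const2 by fastforce
  qed (rule mu.prob_le_1)
  have E_measure: "measure \<mu> E = 1"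
  proof -
    have "AE x in \<mu>. x \<in> (\<Union>i\<in>{k..}. U i)" for k
      using V_measure[of k] by (intro mu.AE_prob_1)
    then have "AE x in \<mu>. \<forall>k. x \<in> (\<Union>i\<in>{k..}. U i)"
      by (subst AE_all_countable) blast
    then have "AE x in \<mu>. x \<in> E" by (simp add: E_def)
    then show ?thesis using E_borel by (subst mu.prob_eq_1) auto
  qed
  have "U i \<subseteq> cyl 0 {}" for i
    unfolding U_def using mu.cyl_interval_subset by blast
  moreover have "E \<subseteq> (\<Union>i\<in>{0..}. U i)" unfolding E_def by (rule INT_lower) simp
  ultimately have "E \<subseteq> cyl 0 {}" by blast
  then have E_bounded: "bounded E"
    unfolding cyl_interval_def by (rule bounded_subset[OF bounded_closed_interval])
  have "hausdorff_billingsley_measure \<alpha> E \<nu> = 0"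
  proof (rule hausdorff_billingsley_measure_eq_0I)
    fix \<epsilon> \<eta> :: real assume "0 < \<epsilon>" "0 < \<eta>"
    have "(\<lambda>k. (1 / 2) ^ k :: real) \<longlonglongrightarrow> 0"
      by (intro LIMSEQ_power_zero) simp
    then have ev1: "\<forall>\<^sub>F k in sequentially. (1 / 2) ^ k < \<epsilon>"
      using \<open>0 < \<epsilon>\<close> by (rule order_tendstoD)
    have "(\<lambda>k. exp (- \<delta>) ^ k * (1 / (1 - exp (- \<delta>)))) \<longlonglongrightarrow> 0 * (1 / (1 - exp (- \<delta>)))"
      using \<delta> by (intro tendsto_intros LIMSEQ_power_zero) auto
    then have ev2: "\<forall>\<^sub>F k in sequentially. exp (- \<delta>) ^ k * (1 / (1 - exp (- \<delta>))) < \<eta>"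
      using \<open>0 < \<eta>\<close> by (intro order_tendstoD(2)[of _ 0]) auto
    obtain k where k: "(1 / 2) ^ k < \<epsilon>" "exp (- \<delta>) ^ k * (1 / (1 - exp (- \<delta>))) < \<eta>"
      using eventually_happens'[OF _ eventually_conj[OF ev1 ev2]] by auto
    \<comment> \<open>The second index runs over all finite sets of naturals through their binary codes.\<close>
    define C where "C i j =
      (if set_decode j \<in> G (k + i) then cyl (r (k + i)) (set_decode j) else {1..0})" for i j
    have "hausdorff_billingsley_pre \<alpha> \<epsilon> E \<nu> \<le> (\<Sum>i. \<Sum>j. ennreal (measure \<nu> (C i j) powr \<alpha>))"
    proof (rule hausdorff_billingsley_pre_le_double_cover)
      show "\<exists>a b. C i j = {a..b}" for i j
        unfolding C_def cyl_interval_def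
        by (cases "set_decode j \<in> G (k + i)") (simp only: if_True if_False, blast)+
      show "measure \<nu> (C i j) \<le> \<epsilon>" for i j
      proof (cases "set_decode j \<in> G (k + i)")
        case True
        then have "set_decode j \<subseteq> {1..r (k + i)}" using G_words by blast
        then have "measure \<nu> (C i j) \<le> (1 / 2) ^ g (r (k + i))"
          using True by (simp add: C_def measure_nu_cyl_le)
        also have "\<dots> \<le> (1 / 2) ^ k"
          using r(1)[of "k + i"] by (intro power_decreasing) auto
        finally show ?thesis using k(1) by simp
      qed (use \<open>0 < \<epsilon>\<close> in \<open>simp add: C_def\<close>)
      show "E \<subseteq> (\<Union>i j. C i j)"
      proof
        fix x assume "x \<in> E"
        then obtain i where "k \<le> i" "x \<in> U i" unfolding E_def by blast
        then obtain A where A: "A \<in> G i" "x \<in> cyl (r i) A" unfolding U_def by blast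
        have "finite A" using A(1) G_words[of i] finite_subset by blast
        then have "x \<in> C (i - k) (set_encode A)" using A \<open>k \<le> i\<close> by (simp add: C_def)
        then show "x \<in> (\<Union>i j. C i j)" by blast
      qed
    qed
    also have "\<dots> \<le> (\<Sum>i. ennreal (exp (- \<delta>) ^ k * exp (- \<delta>) ^ i))"
    proof (intro suminf_le allI)
      fix i
      let ?n = "r (k + i)"
      have fin: "finite A" if "A \<in> G (k + i)" for A
        using that G_words[of "k + i"] finite_subset by blast
      then have inj: "inj_on set_encode (G (k + i))"
        by (intro inj_on_subset[OF inj_on_set_encode]) auto
      have "(\<Sum>j. ennreal (measure \<nu> (C i j) powr \<alpha>))
          = (\<Sum>j\<in>set_encode ` G (k + i). ennreal (measure \<nu> (C i j) powr \<alpha>))"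
      proof (rule suminf_finite)
        fix j assume j: "j \<notin> set_encode ` G (k + i)"
        have "set_decode j \<notin> G (k + i)"
        proof
          assume "set_decode j \<in> G (k + i)"
          then have "set_encode (set_decode j) \<in> set_encode ` G (k + i)" by (rule imageI)
          with j show False by simp
        qed
        then show "ennreal (measure \<nu> (C i j) powr \<alpha>) = 0" by (simp add: C_def)
      qed (use G_fin in simp)
      also have "\<dots> = (\<Sum>A\<in>G (k + i). ennreal (measure \<nu> (cyl ?n A) powr \<alpha>))"
        using fin by (subst sum.reindex[OF inj]) (auto simp: C_def intro!: sum.cong)
      also have "\<dots> \<le> (\<Sum>A\<in>G (k + i). ennreal (((1 / 2) ^ g ?n) powr \<alpha>))"
        using G_words[of "k + i"] \<beta> by (intro sum_mono ennreal_leI powr_mono2 measure_nu_cyl_le) auto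
      also have "\<dots> = ennreal (card (G (k + i)) * ((1 / 2) ^ g ?n) powr \<alpha>)"
        by (simp add: ennreal_of_nat_eq_real_of_nat ennreal_mult)
      also have "\<dots> \<le> ennreal (exp (- \<delta>) ^ k * exp (- \<delta>) ^ i)"
      proof (rule ennreal_leI)
        have half: "((1 / 2) ^ g ?n) powr \<alpha> = exp (- (\<alpha> * ln 2 * g ?n))"
          by (simp add: powr_def ln_realpow ln_div)
        have "card (G (k + i)) * ((1 / 2) ^ g ?n) powr \<alpha>
            \<le> exp (H ?n + \<delta> * g ?n) * exp (- (\<alpha> * ln 2 * g ?n))"
          unfolding half G_def by (intro mult_right_mono card_frequent_words_le) simp
        also have "\<dots> = exp (H ?n + \<delta> * g ?n - \<alpha> * ln 2 * g ?n)"
          by (simp flip: exp_add)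
        also have "\<dots> \<le> exp (- (\<delta> * g ?n))"
        proof -
          have "2 * \<delta> = \<alpha> * ln 2 - \<beta> * ln 2" by (simp add: \<delta>_def left_diff_distrib)
          then have "2 * \<delta> * g ?n = \<alpha> * ln 2 * g ?n - \<beta> * ln 2 * g ?n"
            by (simp only: left_diff_distrib)
          then show ?thesis using r(2)[of "k + i"] by simp
        qed
        also have "\<dots> \<le> exp (- (\<delta> * (k + i)))"
          using \<delta> r(1)[of "k + i"] by simp
        also have "\<dots> = exp (real (k + i) * (- \<delta>))"
          by (simp add: algebra_simps)
        also have "\<dots> = exp (- \<delta>) ^ k * exp (- \<delta>) ^ i"
          by (simp only: exp_of_nat_mult power_add)
        finally show "card (G (k + i)) * ((1 / 2) ^ g ?n) powr \<alpha> \<le> exp (- \<delta>) ^ k * exp (- \<delta>) ^ i" .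
      qed
      finally show "(\<Sum>j. ennreal (measure \<nu> (C i j) powr \<alpha>)) \<le> ennreal (exp (- \<delta>) ^ k * exp (- \<delta>) ^ i)" .
    qed auto
    also have "\<dots> = ennreal (exp (- \<delta>) ^ k * (1 / (1 - exp (- \<delta>))))"
      using \<delta> by (intro suminf_ennreal_eq sums_mult geometric_sums) auto
    also have "\<dots> \<le> ennreal \<eta>"
      using k(2) by (intro ennreal_leI) simp
    finally show "hausdorff_billingsley_pre \<alpha> \<epsilon> E \<nu> \<le> ennreal \<eta>" .
  qed
  then have "hausdorff_billingsley_dim E \<nu> \<le> ereal \<alpha>"
    unfolding hausdorff_billingsley_dim_def using \<beta> by (intro INF_lower) auto
  moreover have "hausdorff_billingsley_dim_measure \<mu> \<nu> \<le> hausdorff_billingsley_dim E \<nu>"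
    unfolding hausdorff_billingsley_dim_measure_def
    using E_borel E_bounded E_measure by (intro INF_lower) auto
  ultimately show ?thesis by (rule order_trans[rotated])
qed

section \<open>Lower bound for the dimension\<close>

text \<open>
  A cylinder interval that meets \<open>{a..b}\<close> without being contained in it contains \<open>a\<close> or \<open>b\<close>; by
  disjointness there are at most two of these. Those of possible words inside \<open>{a..b}\<close> each have
  \<open>\<nu>\<close>-mass \<open>(1 / 2) ^ g n\<close>, so only one can fit.
\<close>

lemma card_met_cyls_le:
  assumes J: "J = {a..b}" and small: "measure \<nu> J < 2 * (1 / 2) ^ g n"
  shows "card {A. A \<subseteq> {1..n} \<and> cyl n A \<inter> J \<noteq> {} \<and> w n A \<noteq> 0} \<le> 3"
proof -
  let ?I = "{A. A \<subseteq> {1..n} \<and> cyl n A \<subseteq> J \<and> w n A \<noteq> 0}"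
  let ?E = "\<lambda>x. {A \<in> Pow {1..n}. x \<in> cyl n A}"
  have fin: "finite ?I" by (rule finite_subset[of _ "Pow {1..n}"]) auto
  have "{A. A \<subseteq> {1..n} \<and> cyl n A \<inter> J \<noteq> {} \<and> w n A \<noteq> 0} \<subseteq> ?I \<union> (?E a \<union> ?E b)"
    unfolding J cyl_interval_def by auto
  then have "card {A. A \<subseteq> {1..n} \<and> cyl n A \<inter> J \<noteq> {} \<and> w n A \<noteq> 0} \<le> card (?I \<union> (?E a \<union> ?E b))"
    using fin by (intro card_mono) auto
  also have "\<dots> \<le> card ?I + (card (?E a) + card (?E b))"
    by (intro order_trans[OF card_Un_le] add_left_mono card_Un_le)
  also have "\<dots> \<le> card ?I + (1 + 1)"
    by (intro add_left_mono add_mono mu.card_cyl_intervals_through_le_1)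
  also have "card ?I \<le> 1"
  proof -
    have "card ?I * (1 / 2) ^ g n = (\<Sum>A\<in>?I. (1 / 2 :: real) ^ g n)"
      by simp
    also have "\<dots> = (\<Sum>A\<in>?I. measure \<nu> (cyl n A))"
      by (intro sum.cong) (auto simp: measure_nu_cyl)
    also have "\<dots> = measure \<nu> (\<Union>A\<in>?I. cyl n A)"
      by (subst nu.measure_Union_cyl) (auto intro!: sum.cong nu.measure_cyl)
    also have "\<dots> \<le> measure \<nu> J"
      by (intro nu.finite_measure_mono) (auto simp: J)
    also have "\<dots> < 2 * (1 / 2) ^ g n" by (rule small)
    finally have "real (card ?I) < 2" by simp
    then show ?thesis by simp
  qed
  finally show ?thesis by simp
qed

text \<open>
  The set \<open>B\<close> stands for the points removed because one of their cylinder intervals is too heavy.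
\<close>

lemma measure_diff_le:
  assumes J: "J = {a..b}" and small: "measure \<nu> J < 2 * (1 / 2) ^ g n"
    and B: "B \<in> sets borel" "\<And>A. A \<in> too_frequent_words \<delta> n \<Longrightarrow> cyl n A \<subseteq> B"
  shows "measure \<mu> (J - B) \<le> 3 * exp (- (H n - \<delta> * g n))"
proof -
  let ?W = "{A. A \<subseteq> {1..n} \<and> cyl n A \<inter> (J - B) \<noteq> {} \<and> w n A \<noteq> 0}"
  have "measure \<mu> (J - B) \<le> (\<Sum>A\<in>?W. w n A)"
    using B(1) by (intro mu.measure_le_sum_met) (auto simp: J)
  also have "\<dots> \<le> (\<Sum>A\<in>?W. exp (- (H n - \<delta> * g n)))"
  proof (rule sum_mono)
    fix A assume A: "A \<in> ?W"
    then have "A \<notin> too_frequent_words \<delta> n" using B(2) by blast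
    with A show "w n A \<le> exp (- (H n - \<delta> * g n))" by (auto simp: too_frequent_words_def)
  qed
  also have "\<dots> = card ?W * exp (- (H n - \<delta> * g n))" by simp
  also have "\<dots> \<le> 3 * exp (- (H n - \<delta> * g n))"
  proof (rule mult_right_mono)
    have "card ?W \<le> card {A. A \<subseteq> {1..n} \<and> cyl n A \<inter> J \<noteq> {} \<and> w n A \<noteq> 0}"
      by (rule card_mono[OF finite_subset[of _ "Pow {1..n}"]]) auto
    also have "\<dots> \<le> 3" by (rule card_met_cyls_le[OF J small])
    finally show "real (card ?W) \<le> 3" by simp
  qed simp
  finally show ?thesis .
qed

text \<open>
  A mass distribution argument. Remove from \<open>E\<close> the set \<open>B\<close> of the points that lie in a too heavy
  cylinder interval at one of the ranks \<open>t m\<close>, \<open>m \<ge> m1\<close>, where \<open>g (t m) = m\<close>. Taking one rank for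
  each value of \<open>g\<close> makes the bounds for the removed masses a geometric series, however many
  deterministic digits there are; so \<open>\<mu> B < 1\<close>. What remains satisfies the Frostman condition
  \<open>\<mu> (J - B) \<le> 3 * \<nu> J powr \<alpha>\<close> for all intervals \<open>J\<close> of small \<open>\<nu>\<close>-mass, which bounds the sums
  over coverings of \<open>E\<close> from below.
\<close>

lemma hausdorff_billingsley_measure_nonzero_of_eventually_greater:
  assumes \<alpha>: "0 < \<alpha>" "\<alpha> < \<beta>"
    and ev: "\<And>n. N \<le> n \<Longrightarrow> \<beta> < H n / (real (g n) * ln 2)"
    and E: "E \<in> sets borel" "measure \<mu> E = 1"
  shows "hausdorff_billingsley_measure \<alpha> E \<nu> \<noteq> 0"
proof
  assume zero: "hausdorff_billingsley_measure \<alpha> E \<nu> = 0"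
  define \<delta> where "\<delta> = (\<beta> - \<alpha>) * ln 2"
  have \<delta>: "0 < \<delta>" using \<alpha> by (simp add: \<delta>_def)
  define c where "c = exp (- rate \<delta>)"
  have c: "0 < c" "c < 1" using rate_pos[OF \<delta>] by (auto simp: c_def)
  define \<rho> where "\<rho> = (1 / 2 :: real) powr \<alpha>"
  have \<rho>: "0 < \<rho>" "\<rho> < 1"
    unfolding \<rho>_def using \<alpha> powr_less_mono2[of \<alpha> "1/2" 1] by auto
  obtain t where t: "\<And>m. g (t m) = m" using ex_g_eq by metis
  have H_ge: "H (t m) \<ge> \<beta> * ln 2 * m" if "g N < m" for m
  proof -
    have "N \<le> t m" using g_mono[of "t m" N] t[of m] that by (intro leI notI) simp
    from ev[OF this] show ?thesis
      using that by (simp add: t pos_less_divide_eq mult.assoc mult.commute mult.left_commute)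
  qed
  have "(\<lambda>m. c ^ m * (1 / (1 - c))) \<longlonglongrightarrow> 0 * (1 / (1 - c))"
    using c by (intro tendsto_intros LIMSEQ_power_zero) auto
  then have "\<forall>\<^sub>F m in sequentially. c ^ m * (1 / (1 - c)) < 1"
    by (intro order_tendstoD(2)[of _ 0]) auto
  then obtain m1 where m1: "g N < m1" "c ^ m1 * (1 / (1 - c)) < 1"
    using eventually_happens'[OF sequentially_bot eventually_conj[OF eventually_gt_at_top[of "g N"]]]
    by blast
  define U where "U i = (\<Union>A\<in>too_frequent_words \<delta> (t (m1 + i)). cyl (t (m1 + i)) A)" for i
  define B where "B = (\<Union>i. U i)"
  have U_borel [measurable]: "U i \<in> sets borel" for i
    unfolding U_def using finite_words by (intro sets.finite_UN) auto
  have B_borel [measurable]: "B \<in> sets borel"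
    unfolding B_def by measurable
  have U_le: "measure \<mu> (U i) \<le> c ^ m1 * c ^ i" for i
  proof -
    have "measure \<mu> (U i) = (\<Sum>A\<in>too_frequent_words \<delta> (t (m1 + i)). w (t (m1 + i)) A)"
      unfolding U_def by (rule mu.measure_Union_cyl) (auto simp: too_frequent_words_def)
    also have "\<dots> \<le> exp (- (rate \<delta> * real (m1 + i)))"
      using sum_too_frequent_words_le[OF \<delta>, of "t (m1 + i)"] by (simp only: t)
    also have "\<dots> = exp (real (m1 + i) * (- rate \<delta>))"
      by (simp add: algebra_simps)
    also have "\<dots> = c ^ (m1 + i)"
      unfolding c_def by (rule exp_of_nat_mult)
    also have "\<dots> = c ^ m1 * c ^ i"
      by (rule power_add)
    finally show ?thesis .
  qed
  have sums: "(\<lambda>i. c ^ m1 * c ^ i) sums (c ^ m1 * (1 / (1 - c)))"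
    using c by (intro sums_mult geometric_sums) auto
  have U_summable: "summable (\<lambda>i. measure \<mu> (U i))"
    by (rule summable_comparison_test'[OF sums_summable[OF sums]]) (use U_le in auto)
  have "measure \<mu> B \<le> (\<Sum>i. measure \<mu> (U i))"
    unfolding B_def using U_summable by (intro mu.finite_measure_subadditive_countably) auto
  also have "\<dots> \<le> c ^ m1 * (1 / (1 - c))"
    using suminf_le[OF U_le U_summable sums_summable[OF sums]] sums_unique[OF sums] by simp
  also have "\<dots> < 1" by (rule m1)
  finally have B_less: "measure \<mu> B < 1" .
  define \<kappa> where "\<kappa> = measure \<mu> (E - B)"
  have \<kappa>: "0 < \<kappa>"
  proof -
    have "measure \<mu> E \<le> measure \<mu> ((E - B) \<union> B)"
      using E(1) by (intro mu.finite_measure_mono) auto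
    also have "\<dots> \<le> \<kappa> + measure \<mu> B"
      unfolding \<kappa>_def using E(1) by (intro measure_Un_le) auto
    finally show ?thesis using E(2) B_less by simp
  qed
  have level: "measure \<mu> (J - B) \<le> 3 * \<rho> ^ m"
    if J: "J = {a..b}" and m: "m1 \<le> m" and v: "measure \<nu> J < 2 * (1 / 2) ^ m" for J a b m
  proof -
    have "measure \<mu> (J - B) \<le> 3 * exp (- (H (t m) - \<delta> * g (t m)))"
    proof (rule measure_diff_le[OF J])
      show "cyl (t m) A \<subseteq> B" if "A \<in> too_frequent_words \<delta> (t m)" for A
      proof -
        have "cyl (t m) A \<subseteq> U (m - m1)" using that m by (auto simp: U_def)
        then show ?thesis unfolding B_def by blast
      qed
    qed (use v t in auto)
    also have "\<dots> \<le> 3 * exp (- (\<alpha> * ln 2 * m))"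
      using H_ge[of m] m m1(1) by (simp add: t \<delta>_def algebra_simps)
    also have "exp (- (\<alpha> * ln 2 * m)) = \<rho> ^ m"
      by (simp add: \<rho>_def powr_def ln_div mult.commute mult.left_commute flip: exp_of_nat_mult)
    finally show ?thesis .
  qed
  have frostman: "measure \<mu> (J - B) \<le> 3 * measure \<nu> J powr \<alpha>"
    if J: "J = {a..b}" and v: "measure \<nu> J \<le> (1 / 2) ^ m1" for J a b
  proof (cases "measure \<nu> J = 0")
    case True
    \<comment> \<open>Every level \<open>m\<close> applies to an interval of mass zero, so its remaining \<open>\<mu>\<close>-mass vanishes.\<close>
    have "(\<lambda>m. 3 * \<rho> ^ m) \<longlonglongrightarrow> 3 * 0"
      using \<rho> by (intro tendsto_intros LIMSEQ_power_zero) auto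
    moreover have "measure \<mu> (J - B) \<le> 3 * \<rho> ^ m" if "m1 \<le> m" for m
      using level[OF J that] True by simp
    ultimately have "measure \<mu> (J - B) \<le> 0"
      by (intro LIMSEQ_le_const[of "\<lambda>m. 3 * \<rho> ^ m"]) auto
    also have "0 \<le> 3 * measure \<nu> J powr \<alpha>" by simp
    finally show ?thesis .
  next
    case False
    then have pos: "0 < measure \<nu> J" by (simp add: zero_less_measure_iff)
    define m where "m = (LEAST m. (1 / 2) ^ m \<le> measure \<nu> J)"
    have "\<exists>m. (1 / 2) ^ m < measure \<nu> J"
      using real_arch_pow_inv[OF pos, of "1 / 2"] by simp
    then have m: "(1 / 2) ^ m \<le> measure \<nu> J"
      unfolding m_def by (metis (mono_tags, lifting) LeastI less_imp_le)
    have less: "measure \<nu> J < 2 * (1 / 2) ^ m"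
    proof (cases m)
      case 0
      then show ?thesis using order_le_less_trans[OF nu.prob_le_1[of J], of 2] by simp
    next
      case (Suc j)
      then have "\<not> (1 / 2) ^ j \<le> measure \<nu> J"
        unfolding m_def by (intro not_less_Least) simp
      then show ?thesis using Suc by simp
    qed
    have "(1 / 2 :: real) ^ m \<le> (1 / 2) ^ m1" using m v by (rule order_trans)
    then have "m1 \<le> m" by (subst (asm) power_decreasing_iff) auto
    from level[OF J this less] have "measure \<mu> (J - B) \<le> 3 * \<rho> ^ m" .
    also have "\<rho> ^ m = ((1 / 2) ^ m) powr \<alpha>"
      by (simp add: \<rho>_def powr_power powr_powr mult.commute flip: powr_realpow)
    also have "\<dots> \<le> measure \<nu> J powr \<alpha>"
      using m \<alpha> by (intro powr_mono2) auto
    finally show ?thesis by simp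
  qed
  have "hausdorff_billingsley_pre \<alpha> ((1 / 2) ^ m1) E \<nu> < ennreal (\<kappa> / 3)"
    using hausdorff_billingsley_pre_eq_0D[OF zero, of "(1 / 2) ^ m1"] \<kappa> by simp
  then obtain C where C: "C \<in> interval_coverings \<nu> ((1 / 2) ^ m1) E"
    and less: "(\<Sum>j. ennreal (measure \<nu> (C j) powr \<alpha>)) < ennreal (\<kappa> / 3)"
    unfolding hausdorff_billingsley_pre_def INF_less_iff by blast
  have C_borel [measurable]: "C j \<in> sets borel" for j
  proof -
    obtain a b where "C j = {a..b}" using C unfolding interval_coverings_def by blast
    then show ?thesis by simp
  qed
  have "ennreal \<kappa> = emeasure \<mu> (E - B)"
    by (simp add: \<kappa>_def mu.emeasure_eq_measure)
  also have "\<dots> \<le> emeasure \<mu> (\<Union>j. C j - B)"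
    using C unfolding interval_coverings_def by (intro emeasure_mono) auto
  also have "\<dots> \<le> (\<Sum>j. emeasure \<mu> (C j - B))"
    by (rule emeasure_subadditive_countably) auto
  also have "\<dots> \<le> (\<Sum>j. 3 * ennreal (measure \<nu> (C j) powr \<alpha>))"
  proof (intro suminf_le allI)
    fix j
    obtain a b where "C j = {a..b}" "measure \<nu> (C j) \<le> (1 / 2) ^ m1"
      using C unfolding interval_coverings_def by blast
    from frostman[OF this] show "emeasure \<mu> (C j - B) \<le> 3 * ennreal (measure \<nu> (C j) powr \<alpha>)"
      by (simp add: mu.emeasure_eq_measure ennreal_leI flip: ennreal_numeral ennreal_mult')
  qed auto
  also have "\<dots> = 3 * (\<Sum>j. ennreal (measure \<nu> (C j) powr \<alpha>))"
    by (rule ennreal_suminf_cmult)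
  also have "\<dots> < 3 * ennreal (\<kappa> / 3)"
    using less by (intro ennreal_mult_strict_left_mono) auto
  also have "\<dots> = ennreal \<kappa>"
    by (simp flip: ennreal_numeral ennreal_mult')
  finally show False by simp
qed

section \<open>The dimension formula\<close>

theorem dim_eq_liminf:
  "hausdorff_billingsley_dim_measure \<mu> \<nu> = liminf (\<lambda>n. ereal (H n / (real (g n) * ln 2)))"
    (is "_ = liminf ?f")
proof (rule antisym)
  show "hausdorff_billingsley_dim_measure \<mu> \<nu> \<le> liminf ?f"
  proof (rule dense_ge)
    fix y assume y: "liminf ?f < y"
    have nonneg: "0 \<le> liminf ?f"
      using H_nonneg by (intro Liminf_bounded always_eventually allI) simp
    obtain \<beta> where \<beta>: "liminf ?f < ereal \<beta>" "ereal \<beta> < y"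
      using ereal_dense2[OF y] by blast
    obtain \<alpha> where \<alpha>: "ereal \<beta> < ereal \<alpha>" "ereal \<alpha> < y"
      using ereal_dense2[OF \<beta>(2)] by blast
    have "hausdorff_billingsley_dim_measure \<mu> \<nu> \<le> ereal \<alpha>"
    proof (rule dim_le_of_frequently_less)
      show "0 < \<beta>" using order_le_less_trans[OF nonneg \<beta>(1)] by simp
      show "\<beta> < \<alpha>" using \<alpha> by simp
      show "\<exists>n\<ge>N. H n / (real (g n) * ln 2) < \<beta>" for N
      proof (rule ccontr)
        assume "\<not> (\<exists>n\<ge>N. H n / (real (g n) * ln 2) < \<beta>)"
        then have "ereal \<beta> \<le> liminf ?f"
          by (intro Liminf_bounded eventually_sequentiallyI[of N]) (auto simp: not_less)
        with \<beta>(1) show False by simp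
      qed
    qed
    with \<alpha>(2) show "hausdorff_billingsley_dim_measure \<mu> \<nu> \<le> y" by simp
  qed
  show "liminf ?f \<le> hausdorff_billingsley_dim_measure \<mu> \<nu>"
    unfolding hausdorff_billingsley_dim_measure_def hausdorff_billingsley_dim_def
  proof (intro INF_greatest)
    fix E \<alpha>
    assume E: "E \<in> {E. bounded E \<and> E \<in> sets borel \<and> measure \<mu> E = 1}"
      and \<alpha>: "\<alpha> \<in> {\<alpha>. \<alpha> > 0 \<and> hausdorff_billingsley_measure \<alpha> E \<nu> = 0}"
    show "liminf ?f \<le> ereal \<alpha>"
    proof (rule ccontr)
      assume "\<not> liminf ?f \<le> ereal \<alpha>"
      then obtain \<beta> where \<beta>: "ereal \<alpha> < ereal \<beta>" "ereal \<beta> < liminf ?f"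
        using ereal_dense2[of "ereal \<alpha>" "liminf ?f"] by (auto simp: not_le)
      from less_LiminfD[OF \<beta>(2)] obtain N where "\<And>n. N \<le> n \<Longrightarrow> \<beta> < H n / (real (g n) * ln 2)"
        by (auto simp: eventually_sequentially)
      then have "hausdorff_billingsley_measure \<alpha> E \<nu> \<noteq> 0"
        using \<alpha> E \<beta>(1) by (intro hausdorff_billingsley_measure_nonzero_of_eventually_greater[of \<alpha> \<beta> N]) auto
      with \<alpha> show False by simp
    qed
  qed
qed

end

theorem theorem7:
  fixes q :: "nat \<Rightarrow> nat"
    and p0 p1 :: "nat \<Rightarrow> real"
    and M :: "'a measure" and \<xi> :: "nat \<Rightarrow> 'a \<Rightarrow> real"
    and N :: "'b measure" and \<xi>s :: "nat \<Rightarrow> 'b \<Rightarrow> real"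
    and \<mu> \<nu>s :: "real measure"
    and h H :: "nat \<Rightarrow> real" and g :: "nat \<Rightarrow> nat"
  assumes q_pos: "\<And>k. k \<ge> 1 \<Longrightarrow> q k > 0"
    and q_growth: "\<And>k. k \<ge> 1 \<Longrightarrow> q (k + 1) \<ge> q k * (q k + 1)"
    and p_nonneg: "\<And>k. k \<ge> 1 \<Longrightarrow> p0 k \<ge> 0 \<and> p1 k \<ge> 0"
    and p_sum: "\<And>k. k \<ge> 1 \<Longrightarrow> p0 k + p1 k = 1"
    and p_inf: "infinite {k. k \<ge> 1 \<and> max (p0 k) (p1 k) < 1}"
    and M: "prob_space M"
    and \<xi>_indep: "prob_space.indep_vars M (\<lambda>_. borel) \<xi> {1..}"
    and \<xi>_0: "\<And>k. k \<ge> 1 \<Longrightarrow> measure M {\<omega> \<in> space M. \<xi> k \<omega> = 0} = p0 k"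
    and \<xi>_1: "\<And>k. k \<ge> 1 \<Longrightarrow> measure M {\<omega> \<in> space M. \<xi> k \<omega> = 1} = p1 k"
    and \<mu>: "\<mu> = distr M borel (\<lambda>\<omega>. alternating_sum q (\<lambda>k. \<xi> k \<omega>))"
    and N: "prob_space N"
    and \<xi>s_indep: "prob_space.indep_vars N (\<lambda>_. borel) \<xi>s {1..}"
    and \<xi>s_0: "\<And>k. k \<ge> 1 \<Longrightarrow>
                 measure N {\<omega> \<in> space N. \<xi>s k \<omega> = 0} = uniform_weight (p0 k)"
    and \<xi>s_1: "\<And>k. k \<ge> 1 \<Longrightarrow>
                 measure N {\<omega> \<in> space N. \<xi>s k \<omega> = 1} = uniform_weight (p1 k)"
    and \<nu>s: "\<nu>s = distr N borel (\<lambda>\<omega>. alternating_sum q (\<lambda>k. \<xi>s k \<omega>))"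
    and h: "\<And>n. h n = binary_entropy (p0 n) (p1 n)"
    and H: "\<And>n. H n = (\<Sum>k=1..n. h k)"
    and g: "\<And>n. g n = card {k \<in> {1..n}. h k > 0}"
  shows "hausdorff_billingsley_dim_measure \<mu> \<nu>s
           = liminf (\<lambda>n. ereal (H n / (real (g n) * ln 2)))"
proof -
  interpret fast_growth q by unfold_locales (fact q_pos, fact q_growth)
  have mu: "digit_distribution q \<mu> p0 p1"
    unfolding \<mu> by (rule digit_distribution_distr[OF M \<xi>_indep p_sum \<xi>_0 \<xi>_1])
  have uniform_sum: "uniform_weight (p0 k) + uniform_weight (p1 k) = 1" if "1 \<le> k" for k
    using p_sum[OF that] by (auto simp: uniform_weight_def)
  have nu: "digit_distribution q \<nu>s (\<lambda>k. uniform_weight (p0 k)) (\<lambda>k. uniform_weight (p1 k))"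
    unfolding \<nu>s by (rule digit_distribution_distr[OF N \<xi>s_indep uniform_sum \<xi>s_0 \<xi>s_1])
  interpret uniform_comparison q \<mu> \<nu>s p0 p1
    by (intro uniform_comparison.intro uniform_comparison_axioms.intro mu nu p_inf)
  have h_eq: "h = uniform_comparison.h p0 p1"
    by (rule ext) (simp add: h h_def)
  show ?thesis
    using dim_eq_liminf by (simp add: H g H_def g_def h_eq)
qed

end
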